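(* Let $F:\mathbb{R}^d\to\mathbb{R}$, $F(x)=\sum_{i=1}^n\psi_i(x)$ with $\psi_i:\mathbb{R}^d\to\mathbb{R}$, be $\mu$-strongly convex. Consider the algorithm Accelerated APPA (described in the context), instantiated with SVRG as the primal oracle $\mathcal{P}$ and with $\lambda=2\mu+LR^2$. This yields the running time bound $$\tilde O\big(nd\sqrt{\kappa}\,\log(\epsilon_0/\epsilon)\big)$$ for solving the general empirical risk minimization problem $\min_{x\in\mathbb{R}^d}\sum_{i=1}^n\psi_i(x)$ to within accuracy $\epsilon$.
   Context: Constants: $\kappa=\lceil LR^2/\mu\rceil$ and $\kappa_\lambda=\lceil LR^2/\lambda\rceil$. In the linear-predictor case $\psi_i(x)=\phi_i(a_i^\top x)$, with $\phi_i:\mathbb{R}\to\mathbb{R}$ convex and $a_i\in\mathbb{R}^d$, $L$ is the smoothness parameter of the $\phi_i$ (that is, $\phi_i(v)\le\phi_i(u)+\phi_i'(u)(v-u)+\frac L2(v-u)^2$ for all $u,v$) and $R=\max_i\|a_i\|_2$. For general $\psi_i$, $L$ and $R$ are the corresponding constants appearing in the SVRG running time below. Let $f_{s,\lambda}(x)=F(x)+\frac\lambda2\|x-s\|_2^2$. A primal $(c,\lambda)$-oracle is an algorithm $\mathcal{P}$ that, given $x\in\mathbb{R}^d$, outputs a point $\mathcal{P}(x)$ with $f_{x,\lambda}(\mathcal{P}(x))-\min f_{x,\lambda}\le\frac1c[f_{x,\lambda}(x)-\min f_{x,\lambda}]$ (in expectation if $\mathcal{P}$ is randomized), in time $\mathcal{T}_{\mathcal{P}}$.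 Fact taken as given: SVRG (stochastic variance-reduced gradient, Johnson and Zhang 2013) is a primal $(c,\lambda)$-oracle with $\mathcal{T}_{\mathcal{P}}=O(nd\min\{\kappa,\kappa_\lambda\}\log c)$ for the general problem $\min_x\sum_i\psi_i(x)$. Accelerated APPA: the input is $x^{(0)}\in\mathbb{R}^d$, $\mu>0$, $\lambda>2\mu$, and a primal $(4\rho^{3/2},\lambda)$-oracle $\mathcal{P}$, where $\rho=\frac{\mu+2\lambda}{\mu}$. Put $\zeta=\frac2\mu+\frac1\lambda$ and $v^{(0)}=x^{(0)}$. For $t=0,\dots,T-1$ set $y^{(t)}=\frac1{1+\rho^{-1/2}}x^{(t)}+\frac{\rho^{-1/2}}{1+\rho^{-1/2}}v^{(t)}$, $x^{(t+1)}=\mathcal{P}(y^{(t)})$, $g^{(t)}=\lambda(y^{(t)}-x^{(t+1)})$, $v^{(t+1)}=(1-\rho^{-1/2})v^{(t)}+\rho^{-1/2}[y^{(t)}-\zeta g^{(t)}]$. Output $x^{(T)}$, with $T$ chosen according to the target accuracy. Accuracy $\epsilon$ means that the output $x$ satisfies $F(x)-\min F\le\epsilon$, in expectation since SVRG is randomized; $\epsilon_0=F(x^{(0)})-\min F$. $\tilde O(\cdot)$ hides factors polylogarithmic in $n,L,\mu,\lambda,R$.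
   Formalization: SVRG is run to some accuracy c ≥ 4ρ^{3/2} depending on n, μ, L, R, since the oracle guarantee at exactly 4ρ^{3/2} does not ensure convergence; each ψ_i is taken LR²-smooth, and ε_0/ε is bounded away from 1. *)

theory Defs
  imports "HOL-Probability.Probability_Mass_Function" "Jordan_Normal_Form.Matrix"
begin

text \<open>The O-constants of the main statement must be uniform in the dimension \<open>d\<close>, so \<open>d\<close> cannot be
  a type: the space \<open>\<real>\<^sup>d\<close> is \<open>carrier_vec d\<close>, and functions on \<open>\<real>\<^sup>d\<close> only matter on this carrier.\<close>

type_synonym rvec = "real Matrix.vec"

definition vnorm :: "rvec \<Rightarrow> real" where
  "vnorm v = sqrt (scalar_prod v v)"

text \<open>For the strongly convex functions considered below the infimum is attained, i.e. it is the
  minimum.\<close>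

definition min_val :: "nat \<Rightarrow> (rvec \<Rightarrow> real) \<Rightarrow> real" where
  "min_val d f = (INF x\<in>carrier_vec d. f x)"

definition strongly_convex :: "nat \<Rightarrow> real \<Rightarrow> (rvec \<Rightarrow> real) \<Rightarrow> bool" where
  "strongly_convex d \<mu> f \<longleftrightarrow>
     (\<forall>x\<in>carrier_vec d. \<forall>y\<in>carrier_vec d. \<forall>t\<in>{0..1}.
        f (t \<cdot>\<^sub>v x + (1 - t) \<cdot>\<^sub>v y)
          \<le> t * f x + (1 - t) * f y - \<mu> / 2 * t * (1 - t) * (vnorm (x - y))\<^sup>2)"

definition has_gradient :: "nat \<Rightarrow> (rvec \<Rightarrow> real) \<Rightarrow> rvec \<Rightarrow> rvec \<Rightarrow> bool" where
  "has_gradient d f g x \<longleftrightarrow> g \<in> carrier_vec d \<and>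
     (\<forall>e>0. \<exists>\<delta>>0. \<forall>y\<in>carrier_vec d. vnorm (y - x) < \<delta> \<longrightarrow>
        \<bar>f y - f x - scalar_prod g (y - x)\<bar> \<le> e * vnorm (y - x))"

definition smooth :: "nat \<Rightarrow> real \<Rightarrow> (rvec \<Rightarrow> real) \<Rightarrow> bool" where
  "smooth d M f \<longleftrightarrow>
     (\<forall>x\<in>carrier_vec d. \<exists>g. has_gradient d f g x \<and>
        (\<forall>y\<in>carrier_vec d. f y \<le> f x + scalar_prod g (y - x) + M / 2 * (vnorm (y - x))\<^sup>2))"

text \<open>Sanity check relating \<open>L\<close> and \<open>R\<close> to the linear-predictor case.\<close>

lemma scalar_prod_abs_le:
  fixes a b :: rvec
  assumes "a \<in> carrier_vec d" "b \<in> carrier_vec d"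
  shows "\<bar>scalar_prod a b\<bar> \<le> vnorm a * vnorm b"
proof -
  have "(scalar_prod a b)\<^sup>2 \<le> scalar_prod a a * scalar_prod b b"
    using assms Cauchy_Schwarz_ineq_sum[of "\<lambda>i. vec_index a i" "\<lambda>i. vec_index b i" "{0..<d}"]
    by (simp add: scalar_prod_def power2_eq_square)
  then have "sqrt ((scalar_prod a b)\<^sup>2) \<le> sqrt (scalar_prod a a * scalar_prod b b)"
    by (rule real_sqrt_le_mono)
  then show ?thesis by (simp add: vnorm_def real_sqrt_mult)
qed

lemma vnorm_nonneg: "0 \<le> vnorm v"
  by (simp add: vnorm_def scalar_prod_def sum_nonneg)

lemma linear_predictor_smooth:
  fixes \<phi> \<phi>' :: "real \<Rightarrow> real"
  assumes deriv: "\<And>u. (\<phi> has_real_derivative \<phi>' u) (at u)"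
    and bound: "\<And>u v. \<phi> v \<le> \<phi> u + \<phi>' u * (v - u) + L / 2 * (v - u)\<^sup>2"
    and a: "a \<in> carrier_vec d" and R: "vnorm a \<le> R" and L: "0 \<le> L"
  shows "smooth d (L * R\<^sup>2) (\<lambda>x. \<phi> (scalar_prod a x))"
  unfolding smooth_def
proof
  fix x :: rvec assume x: "x \<in> carrier_vec d"
  have R0: "0 \<le> R" using R vnorm_nonneg[of a] by linarith
  define u where "u = scalar_prod a x"
  define g where "g = \<phi>' u \<cdot>\<^sub>v a"
  have g: "g \<in> carrier_vec d" using a by (simp add: g_def)
  have diff: "scalar_prod a y - u = scalar_prod a (y - x)" if "y \<in> carrier_vec d" for y
    using that x a by (simp add: u_def scalar_prod_minus_distrib)
  have gd: "scalar_prod g (y - x) = \<phi>' u * (scalar_prod a y - u)" if "y \<in> carrier_vec d" for y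
    using that x a diff[OF that] by (simp add: g_def)
  have cs: "\<bar>scalar_prod a y - u\<bar> \<le> R * vnorm (y - x)" if "y \<in> carrier_vec d" for y
  proof -
    have "\<bar>scalar_prod a (y - x)\<bar> \<le> vnorm a * vnorm (y - x)"
      using that x a by (intro scalar_prod_abs_le[of _ d]) auto
    also have "\<dots> \<le> R * vnorm (y - x)" using R vnorm_nonneg by (rule mult_right_mono)
    finally show ?thesis using diff[OF that] by simp
  qed
  have "has_gradient d (\<lambda>x. \<phi> (scalar_prod a x)) g x"
    unfolding has_gradient_def
  proof (intro conjI allI impI g)
    fix e :: real assume e: "0 < e"
    have e': "0 < e / (R + 1)" using e R0 by simp
    have "(\<phi> has_derivative (*) (\<phi>' u)) (at u)"
      using deriv[of u] by (simp add: has_field_derivative_def)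
    then obtain \<eta> where \<eta>: "0 < \<eta>"
      and h: "\<And>w. \<bar>w - u\<bar> < \<eta> \<Longrightarrow> \<bar>\<phi> w - \<phi> u - \<phi>' u * (w - u)\<bar> \<le> e / (R + 1) * \<bar>w - u\<bar>"
      using e' unfolding has_derivative_at_alt by (auto simp: real_norm_def)
    show "\<exists>\<delta>>0. \<forall>y\<in>carrier_vec d. vnorm (y - x) < \<delta> \<longrightarrow>
      \<bar>\<phi> (scalar_prod a y) - \<phi> (scalar_prod a x) - scalar_prod g (y - x)\<bar> \<le> e * vnorm (y - x)"
    proof (intro exI[of _ "\<eta> / (R + 1)"] conjI ballI impI)
      show "0 < \<eta> / (R + 1)" using \<eta> R0 by simp
      fix y assume y: "y \<in> carrier_vec d" and yd: "vnorm (y - x) < \<eta> / (R + 1)"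
      have le: "\<bar>scalar_prod a y - u\<bar> \<le> (R + 1) * vnorm (y - x)"
        using cs[OF y] vnorm_nonneg[of "y - x"] by (simp add: algebra_simps)
      also have "\<dots> < \<eta>" using yd R0 by (simp add: field_simps)
      finally have "\<bar>scalar_prod a y - u\<bar> < \<eta>" .
      then have "\<bar>\<phi> (scalar_prod a y) - \<phi> u - \<phi>' u * (scalar_prod a y - u)\<bar>
          \<le> e / (R + 1) * \<bar>scalar_prod a y - u\<bar>" by (rule h)
      also have "\<dots> \<le> e / (R + 1) * ((R + 1) * vnorm (y - x))"
        using le e' by (intro mult_left_mono) auto
      also have "\<dots> = e * vnorm (y - x)" using R0 by simp
      finally show "\<bar>\<phi> (scalar_prod a y) - \<phi> (scalar_prod a x) - scalar_prod g (y - x)\<bar>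
          \<le> e * vnorm (y - x)" using gd[OF y] by (simp add: u_def)
    qed
  qed
  moreover have "\<phi> (scalar_prod a y) \<le> \<phi> (scalar_prod a x) + scalar_prod g (y - x)
      + L * R\<^sup>2 / 2 * (vnorm (y - x))\<^sup>2" if y: "y \<in> carrier_vec d" for y
  proof -
    have "(scalar_prod a y - u)\<^sup>2 \<le> (R * vnorm (y - x))\<^sup>2"
      using cs[OF y] by (metis abs_ge_zero power2_abs power_mono)
    then have "L / 2 * (scalar_prod a y - u)\<^sup>2 \<le> L / 2 * (R * vnorm (y - x))\<^sup>2"
      using L by (intro mult_left_mono) auto
    then show ?thesis
      using bound[of "scalar_prod a y" u] gd[OF y] by (simp add: u_def power_mult_distrib)
  qed
  ultimately show "\<exists>g. has_gradient d (\<lambda>x. \<phi> (scalar_prod a x)) g x \<and>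
      (\<forall>y\<in>carrier_vec d. \<phi> (scalar_prod a y) \<le> \<phi> (scalar_prod a x) + scalar_prod g (y - x)
        + L * R\<^sup>2 / 2 * (vnorm (y - x))\<^sup>2)" by blast
qed

definition prox_obj :: "(rvec \<Rightarrow> real) \<Rightarrow> rvec \<Rightarrow> real \<Rightarrow> rvec \<Rightarrow> real" where
  "prox_obj F s lam x = F x + lam / 2 * (vnorm (x - s))\<^sup>2"

text \<open>A randomized computation is a distribution over pairs of a result and the number of elementary
  steps spent on it (real RAM: one step per arithmetic operation or square root on reals).\<close>

type_synonym 'a timed = "('a \<times> nat) pmf"

definition charge :: "nat \<Rightarrow> 'a \<Rightarrow> 'a timed" where
  "charge k a = return_pmf (a, k)"

definition tbind :: "'a timed \<Rightarrow> ('a \<Rightarrow> 'b timed) \<Rightarrow> 'b timed" where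
  "tbind m f = bind_pmf m (\<lambda>(a, s). map_pmf (\<lambda>(b, t). (b, s + t)) (f a))"

definition time_at_most :: "real \<Rightarrow> 'a timed \<Rightarrow> bool" where
  "time_at_most B m \<longleftrightarrow> (\<forall>(a, t)\<in>set_pmf m. real t \<le> B)"

text \<open>Integrability is required explicitly, because the Bochner integral of a non-integrable function
  is \<open>0\<close> by convention.\<close>

definition expect_le :: "'a timed \<Rightarrow> ('a \<Rightarrow> real) \<Rightarrow> real \<Rightarrow> bool" where
  "expect_le m f B \<longleftrightarrow>
     integrable (measure_pmf m) (\<lambda>w. f (fst w)) \<and>
     measure_pmf.expectation m (\<lambda>w. f (fst w)) \<le> B"

text \<open>\<open>primal_oracle d F c lam \<tau> P\<close>: \<open>P\<close> is a primal \<open>(c, lam)\<close>-oracle for \<open>F\<close> with running time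
  at most \<open>\<tau>\<close>.\<close>

definition primal_oracle ::
  "nat \<Rightarrow> (rvec \<Rightarrow> real) \<Rightarrow> real \<Rightarrow> real \<Rightarrow> real \<Rightarrow> (rvec \<Rightarrow> rvec timed) \<Rightarrow> bool" where
  "primal_oracle d F c lam \<tau> P \<longleftrightarrow>
     (\<forall>x\<in>carrier_vec d.
        fst ` set_pmf (P x) \<subseteq> carrier_vec d \<and>
        time_at_most \<tau> (P x) \<and>
        expect_le (P x) (\<lambda>z. prox_obj F x lam z - min_val d (prox_obj F x lam))
          (1 / c * (prox_obj F x lam x - min_val d (prox_obj F x lam))))"

definition cond_nr :: "real \<Rightarrow> real \<Rightarrow> real \<Rightarrow> real" where
  "cond_nr L R \<mu> = real_of_int \<lceil>L * R\<^sup>2 / \<mu>\<rceil>"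

text \<open>SVRG enters through its known guarantee. \<open>S lam c\<close> is SVRG applied to the regularized problem
  with parameter \<open>lam\<close> and run to relative accuracy \<open>1 / c\<close>, and \<open>A\<close> is its O-constant. The range
  \<open>c \<ge> 2\<close> keeps \<open>ln c\<close> away from \<open>0\<close>, where an O-bound by \<open>ln c\<close> would be meaningless.\<close>

definition svrg_guarantee ::
  "real \<Rightarrow> nat \<Rightarrow> nat \<Rightarrow> (rvec \<Rightarrow> real) \<Rightarrow> real \<Rightarrow> real \<Rightarrow> real
     \<Rightarrow> (real \<Rightarrow> real \<Rightarrow> rvec \<Rightarrow> rvec timed) \<Rightarrow> bool" where
  "svrg_guarantee A n d F \<mu> L R S \<longleftrightarrow>
     (\<forall>lam>0. \<forall>c\<ge>2.
        primal_oracle d F c lam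
          (A * (real n * real d * min (cond_nr L R \<mu>) (cond_nr L R lam) * ln c)) (S lam c))"

definition appa_rho :: "real \<Rightarrow> real \<Rightarrow> real" where
  "appa_rho \<mu> lam = (\<mu> + 2 * lam) / \<mu>"

text \<open>One iteration, on the state \<open>(x, v)\<close>. Each scaling, sum or difference of vectors costs \<open>d\<close>
  steps, and the oracle call costs its own time.\<close>

definition appa_step ::
  "nat \<Rightarrow> real \<Rightarrow> real \<Rightarrow> (rvec \<Rightarrow> rvec timed) \<Rightarrow> rvec \<times> rvec \<Rightarrow> (rvec \<times> rvec) timed" where
  "appa_step d \<mu> lam P = (\<lambda>(x, v).
     let r = appa_rho \<mu> lam powr (- 1 / 2); \<zeta> = 2 / \<mu> + 1 / lam in
     tbind (charge (3 * d) (1 / (1 + r) \<cdot>\<^sub>v x + r / (1 + r) \<cdot>\<^sub>v v)) (\<lambda>y.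
     tbind (P y) (\<lambda>x'.
     tbind (charge (2 * d) (lam \<cdot>\<^sub>v (y - x'))) (\<lambda>g.
     tbind (charge (5 * d) ((1 - r) \<cdot>\<^sub>v v + r \<cdot>\<^sub>v (y - \<zeta> \<cdot>\<^sub>v g))) (\<lambda>v'.
     charge 0 (x', v'))))))"

text \<open>The initial charge accounts for copying \<open>x0\<close> into \<open>v\<close> and for computing once
  \<open>\<rho>\<close> (3 operations), \<open>r = 1 / sqrt \<rho>\<close> (2), \<open>\<zeta>\<close> (3), \<open>1 / (1 + r)\<close> (2), \<open>r / (1 + r)\<close> (1) and
  \<open>1 - r\<close> (1).\<close>

primrec appa_state ::
  "nat \<Rightarrow> real \<Rightarrow> real \<Rightarrow> (rvec \<Rightarrow> rvec timed) \<Rightarrow> rvec \<Rightarrow> nat \<Rightarrow> (rvec \<times> rvec) timed" where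
  "appa_state d \<mu> lam P x0 0 = charge (d + 12) (x0, x0)"
| "appa_state d \<mu> lam P x0 (Suc t) = tbind (appa_state d \<mu> lam P x0 t) (appa_step d \<mu> lam P)"

definition accelerated_appa ::
  "nat \<Rightarrow> real \<Rightarrow> real \<Rightarrow> (rvec \<Rightarrow> rvec timed) \<Rightarrow> rvec \<Rightarrow> nat \<Rightarrow> rvec timed" where
  "accelerated_appa d \<mu> lam P x0 T =
     tbind (appa_state d \<mu> lam P x0 T) (\<lambda>(x, v). charge 0 x)"

text \<open>A generic polylogarithmic factor in \<open>n, L, \<mu>, \<lambda>, R\<close>; absolute values since the real parameters
  may be below \<open>1\<close>.\<close>

definition polylog :: "nat \<Rightarrow> nat \<Rightarrow> real \<Rightarrow> real \<Rightarrow> real \<Rightarrow> real \<Rightarrow> real" where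
  "polylog k n L \<mu> lam R =
     (1 + \<bar>ln (real n)\<bar> + \<bar>ln L\<bar> + \<bar>ln \<mu>\<bar> + \<bar>ln lam\<bar> + \<bar>ln R\<bar>) ^ k"

end

theory Submission
  imports Defs
begin

text \<open>Write \<open>F\<^sub>*\<close> for the infimum of \<open>F\<close> and \<open>r = \<rho>\<^bsup>-1/2\<^esup>\<close>. Strong convexity of the regularized
  objective at the oracle output \<open>x'\<close> gives, with \<open>\<delta>\<close> the remaining gap at \<open>x'\<close> and for every \<open>w\<close>,
  \<open>F w \<ge> F x' + \<lambda>/2 |x' - y|\<^sup>2 + (\<lambda> + \<mu>/2)/2 |w - x'|\<^sup>2 - \<lambda>/2 |w - y|\<^sup>2 - (1 + \<rho>) \<delta>\<close>.
  As a function of \<open>w\<close> the right-hand side is a quadratic of curvature \<open>\<mu>/2\<close> centred at \<open>y - \<zeta> g\<close>.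
  Adding \<open>1 - r\<close> times the bound at \<open>w = x\<close> to \<open>r\<close> times the bound at a point \<open>w = u\<close> with
  \<open>F u \<le> F\<^sub>* + \<eta>\<close> shows that the potential \<open>F x - F\<^sub>* + \<mu>/4 |v - u|\<^sup>2\<close> contracts by \<open>1 - r\<close> up to
  \<open>r \<eta> + (1 + \<rho>) \<delta>\<close>. The oracle makes \<open>\<delta>\<close> small relative to \<open>F y - F\<^sub>*\<close>, which smoothness of \<open>F\<close>
  bounds by a multiple of the potential, so the expected potential contracts by \<open>1 - r/2\<close> once \<open>c\<close>
  is polynomial in \<open>n L R\<^sup>2 / \<mu>\<close>, hence \<open>ln c\<close> is logarithmic. Using near-minimizers and letting
  \<open>\<eta> \<rightarrow> 0\<close> avoids proving that minima are attained. Finally \<open>\<lambda> > L R\<^sup>2\<close> gives \<open>\<kappa>\<^sub>\<lambda> = 1\<close>, while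
  \<open>\<rho> = O(\<kappa>)\<close>.\<close>

subsection \<open>Smooth and strongly convex functions\<close>

lemma vnorm_diff_sq:
  assumes "a \<in> carrier_vec d" "b \<in> carrier_vec d"
  shows "(vnorm (a - b))\<^sup>2 = (\<Sum>i<d. (vec_index a i - vec_index b i)\<^sup>2)"
  using assms
  by (auto simp: vnorm_def scalar_prod_def sum_nonneg power2_eq_square atLeast0LessThan
      intro!: sum.cong)

lemma vnorm_sq: "(vnorm a)\<^sup>2 = scalar_prod a a"
  by (simp add: vnorm_def scalar_prod_def sum_nonneg)

lemma has_gradient_add:
  assumes f: "has_gradient d f g x" and f': "has_gradient d f' g' x"
    and x: "x \<in> carrier_vec d"
  shows "has_gradient d (\<lambda>y. f y + f' y) (g + g') x"
  unfolding has_gradient_def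
proof (intro conjI allI impI)
  have g: "g \<in> carrier_vec d" "g' \<in> carrier_vec d"
    using f f' by (auto simp: has_gradient_def)
  then show "g + g' \<in> carrier_vec d" by simp
  fix e :: real assume "e > 0"
  then have e2: "e / 2 > 0" by simp
  obtain a where a: "a > 0" "\<And>y. y \<in> carrier_vec d \<Longrightarrow> vnorm (y - x) < a \<Longrightarrow>
      \<bar>f y - f x - scalar_prod g (y - x)\<bar> \<le> e / 2 * vnorm (y - x)"
    using f e2 unfolding has_gradient_def by meson
  obtain b where b: "b > 0" "\<And>y. y \<in> carrier_vec d \<Longrightarrow> vnorm (y - x) < b \<Longrightarrow>
      \<bar>f' y - f' x - scalar_prod g' (y - x)\<bar> \<le> e / 2 * vnorm (y - x)"
    using f' e2 unfolding has_gradient_def by meson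
  show "\<exists>\<delta>>0. \<forall>y\<in>carrier_vec d. vnorm (y - x) < \<delta> \<longrightarrow>
    \<bar>f y + f' y - (f x + f' x) - scalar_prod (g + g') (y - x)\<bar> \<le> e * vnorm (y - x)"
  proof (intro exI[of _ "min a b"] conjI ballI impI)
    show "0 < min a b" using a b by simp
    fix y assume y: "y \<in> carrier_vec d" "vnorm (y - x) < min a b"
    have "scalar_prod (g + g') (y - x) = scalar_prod g (y - x) + scalar_prod g' (y - x)"
      using g x y by (intro add_scalar_prod_distrib[of _ d]) auto
    then show "\<bar>f y + f' y - (f x + f' x) - scalar_prod (g + g') (y - x)\<bar> \<le> e * vnorm (y - x)"
      using a(2)[of y] b(2)[of y] y unfolding abs_le_iff by (simp add: algebra_simps)
  qed
qed

lemma smooth_add: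
  assumes "smooth d M f" "smooth d M' f'"
  shows "smooth d (M + M') (\<lambda>x. f x + f' x)"
  unfolding smooth_def
proof
  fix x :: rvec assume x: "x \<in> carrier_vec d"
  obtain g where g: "has_gradient d f g x"
    "\<And>y. y \<in> carrier_vec d \<Longrightarrow> f y \<le> f x + scalar_prod g (y - x) + M / 2 * (vnorm (y - x))\<^sup>2"
    using assms(1) x unfolding smooth_def by blast
  obtain g' where g': "has_gradient d f' g' x"
    "\<And>y. y \<in> carrier_vec d \<Longrightarrow> f' y \<le> f' x + scalar_prod g' (y - x) + M' / 2 * (vnorm (y - x))\<^sup>2"
    using assms(2) x unfolding smooth_def by blast
  have c: "g \<in> carrier_vec d" "g' \<in> carrier_vec d"
    using g(1) g'(1) by (auto simp: has_gradient_def)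
  have "f y + f' y \<le> f x + f' x + scalar_prod (g + g') (y - x) + (M + M') / 2 * (vnorm (y - x))\<^sup>2"
    if y: "y \<in> carrier_vec d" for y
  proof -
    have "scalar_prod (g + g') (y - x) = scalar_prod g (y - x) + scalar_prod g' (y - x)"
      using c x y by (intro add_scalar_prod_distrib[of _ d]) auto
    then show ?thesis using g(2)[OF y] g'(2)[OF y] by (simp add: algebra_simps add_divide_distrib)
  qed
  then show "\<exists>h. has_gradient d (\<lambda>y. f y + f' y) h x \<and> (\<forall>y\<in>carrier_vec d. f y + f' y
      \<le> f x + f' x + scalar_prod h (y - x) + (M + M') / 2 * (vnorm (y - x))\<^sup>2)"
    using has_gradient_add[OF g(1) g'(1) x] by blast
qed

lemma smooth_zero: "smooth d 0 (\<lambda>_. 0)"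
  unfolding smooth_def
proof
  fix x :: rvec assume x: "x \<in> carrier_vec d"
  have z: "scalar_prod (0\<^sub>v d) (y - x) = 0" if "y \<in> carrier_vec d" for y :: rvec
    using that x by (intro scalar_prod_left_zero) auto
  then have "has_gradient d (\<lambda>_. 0) (0\<^sub>v d) x"
    unfolding has_gradient_def by (auto simp: vnorm_nonneg intro: exI[of _ 1])
  then show "\<exists>g. has_gradient d (\<lambda>_. 0) g x \<and> (\<forall>y\<in>carrier_vec d.
      0 \<le> 0 + scalar_prod g (y - x) + 0 / 2 * (vnorm (y - x))\<^sup>2)"
    using z by (intro exI[of _ "0\<^sub>v d"]) simp
qed

text \<open>Gives the smoothness constant \<open>n * (L * R\<^sup>2)\<close> of \<open>F\<close>. It
  enters only through the oracle accuracy, so its factor \<open>n\<close> costs just a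
  logarithm.\<close>

lemma smooth_sum:
  assumes "\<And>i. i \<in> {1..n} \<Longrightarrow> smooth d M (\<psi> i)"
  shows "smooth d (real n * M) (\<lambda>x. \<Sum>i=1..n. \<psi> i x)"
  using assms
proof (induction n)
  case 0
  then show ?case by (simp add: smooth_zero)
next
  case (Suc n)
  have "smooth d (real n * M + M) (\<lambda>x. (\<Sum>i=1..n. \<psi> i x) + \<psi> (Suc n) x)"
    using Suc by (intro smooth_add) auto
  then show ?case by (simp add: algebra_simps)
qed

text \<open>The squared distance to \<open>s\<close> turns the convexity inequality into an
  identity, checked coordinate by coordinate, so the regularizer adds exactly \<open>lam\<close> to
  the modulus.\<close>

lemma strongly_convex_prox_obj:
  assumes F: "strongly_convex d \<mu> F" and s: "s \<in> carrier_vec d"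
  shows "strongly_convex d (\<mu> + lam) (prox_obj F s lam)"
  unfolding strongly_convex_def
proof (intro ballI)
  fix x y :: rvec and t :: real
  assume xy: "x \<in> carrier_vec d" "y \<in> carrier_vec d" and t: "t \<in> {0..1}"
  let ?z = "t \<cdot>\<^sub>v x + (1 - t) \<cdot>\<^sub>v y"
  have "(vnorm (?z - s))\<^sup>2
      = (\<Sum>i<d. t * (vec_index x i - vec_index s i)\<^sup>2 + (1 - t) * (vec_index y i - vec_index s i)\<^sup>2
          - t * (1 - t) * (vec_index x i - vec_index y i)\<^sup>2)"
    using xy s by (subst vnorm_diff_sq[of _ d])
      (auto intro!: sum.cong simp: power2_eq_square algebra_simps)
  also have "\<dots> = t * (vnorm (x - s))\<^sup>2 + (1 - t) * (vnorm (y - s))\<^sup>2 - t * (1 - t) * (vnorm (x - y))\<^sup>2"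
    using xy s by (simp add: vnorm_diff_sq[of _ d] sum.distrib sum_subtractf sum_distrib_left)
  finally have *: "lam / 2 * (vnorm (?z - s))\<^sup>2 = lam / 2 * (t * (vnorm (x - s))\<^sup>2
      + (1 - t) * (vnorm (y - s))\<^sup>2 - t * (1 - t) * (vnorm (x - y))\<^sup>2)" by simp
  have "F ?z \<le> t * F x + (1 - t) * F y - \<mu> / 2 * t * (1 - t) * (vnorm (x - y))\<^sup>2"
    using F xy t unfolding strongly_convex_def by blast
  then show "prox_obj F s lam ?z \<le> t * prox_obj F s lam x + (1 - t) * prox_obj F s lam y
      - (\<mu> + lam) / 2 * t * (1 - t) * (vnorm (x - y))\<^sup>2"
    unfolding prox_obj_def * by (simp add: algebra_simps add_divide_distrib diff_divide_distrib)
qed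

lemma min_val_le:
  assumes "bdd_below (h ` carrier_vec d)" "x \<in> carrier_vec d"
  shows "min_val d h \<le> h x"
  unfolding min_val_def using assms by (rule cINF_lower)

text \<open>Replaces quadratic growth around a minimizer by growth around an arbitrary
  \<open>b\<close>: compare the infimum with the value at \<open>t a + (1 - t) b\<close> and divide
  by \<open>t\<close>. Small \<open>t\<close> keeps more curvature but magnifies the gap at
  \<open>b\<close>.\<close>

lemma strongly_convex_gap:
  assumes h: "strongly_convex d m h" "bdd_below (h ` carrier_vec d)"
    and ab: "a \<in> carrier_vec d" "b \<in> carrier_vec d" and t: "0 < t" "t \<le> 1"
  shows "h b + m / 2 * (1 - t) * (vnorm (a - b))\<^sup>2 - (h b - min_val d h) / t \<le> h a"
proof -
  let ?z = "t \<cdot>\<^sub>v a + (1 - t) \<cdot>\<^sub>v b"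
  have "min_val d h \<le> h ?z" using h(2) ab by (intro min_val_le) auto
  also have "\<dots> \<le> t * h a + (1 - t) * h b - m / 2 * t * (1 - t) * (vnorm (a - b))\<^sup>2"
    using h(1) ab t unfolding strongly_convex_def by auto
  finally have "t * h b + t * (m / 2 * (1 - t) * (vnorm (a - b))\<^sup>2) - (h b - min_val d h) \<le> t * h a"
    by (simp add: algebra_simps)
  also have "t * h b + t * (m / 2 * (1 - t) * (vnorm (a - b))\<^sup>2) - (h b - min_val d h)
      = t * (h b + m / 2 * (1 - t) * (vnorm (a - b))\<^sup>2 - (h b - min_val d h) / t)"
    using t by (simp add: field_simps)
  finally show ?thesis using t by simp
qed

text \<open>A gradient at one point bounds \<open>F\<close> from below linearly near
  \<open>x\<close>. Convexity along the segment carries this to \<open>y\<close> as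
  \<open>F x - (|g| + 1) D + \<mu>/4 D^2\<close>, which is bounded below in
  \<open>D\<close>.\<close>

lemma strongly_convex_bdd_below:
  assumes F: "strongly_convex d \<mu> F" and \<mu>: "\<mu> > 0"
    and x: "x \<in> carrier_vec d" and grad: "has_gradient d F g x"
  shows "bdd_below (F ` carrier_vec d)"
proof (rule bdd_belowI2)
  fix y :: rvec assume y: "y \<in> carrier_vec d"
  have g: "g \<in> carrier_vec d" using grad by (simp add: has_gradient_def)
  \<comment> \<open>Tolerance 1 is enough: the error only enlarges the slope to
    \<open>|g| + 1\<close>.\<close>
  obtain \<delta> where \<delta>: "\<delta> > 0" "\<And>z. z \<in> carrier_vec d \<Longrightarrow> vnorm (z - x) < \<delta> \<Longrightarrow>
      \<bar>F z - F x - scalar_prod g (z - x)\<bar> \<le> 1 * vnorm (z - x)"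
    using grad unfolding has_gradient_def by (elim conjE allE[of _ 1]) auto
  define D where "D = vnorm (y - x)"
  \<comment> \<open>The bound 1/2 preserves half of the curvature; the other bound keeps
    \<open>t * D\<close> below \<open>\<delta>\<close>, with \<open>D + 1\<close> guarding against
    \<open>D = 0\<close>.\<close>
  define t where "t = min (1/2) (\<delta> / (2 * (D + 1)))"
  have D: "D \<ge> 0" by (simp add: D_def vnorm_nonneg)
  have t: "0 < t" "t \<le> 1 / 2"
    unfolding t_def using \<delta>(1) D by simp (rule min.cobounded1)
  let ?z = "t \<cdot>\<^sub>v y + (1 - t) \<cdot>\<^sub>v x"
  have z: "?z - x = t \<cdot>\<^sub>v (y - x)" "?z \<in> carrier_vec d"
    using x y by (auto simp: algebra_simps)
  have nz: "vnorm (?z - x) = t * D"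
  proof -
    have "vnorm (?z - x) = sqrt (t\<^sup>2 * scalar_prod (y - x) (y - x))"
      using x y unfolding z(1) vnorm_def
      by (simp add: power2_eq_square mult.assoc)
    then show ?thesis using t by (simp add: real_sqrt_mult D_def vnorm_def)
  qed
  have "t * D \<le> \<delta> / (2 * (D + 1)) * D"
    using D by (intro mult_right_mono) (auto simp: t_def)
  also have "\<dots> < \<delta>" using \<delta>(1) D by (simp add: field_simps) (smt (verit) mult_nonneg_nonneg)
  finally have "\<bar>F ?z - F x - scalar_prod g (?z - x)\<bar> \<le> t * D"
    using \<delta>(2)[OF z(2)] nz by simp
  moreover have "scalar_prod g (?z - x) = t * scalar_prod g (y - x)"
    using g x y unfolding z(1) by (intro scalar_prod_smult_right) auto
  moreover have "\<bar>scalar_prod g (y - x)\<bar> \<le> vnorm g * D"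
    unfolding D_def using g x y by (intro scalar_prod_abs_le) auto
  then have "t * \<bar>scalar_prod g (y - x)\<bar> \<le> t * (vnorm g * D)"
    using t by (intro mult_left_mono) auto
  then have "- (t * (vnorm g * D)) \<le> t * scalar_prod g (y - x)"
    using t by (smt (verit) mult_minus_right mult_left_mono)
  moreover have "F ?z \<le> t * F y + (1 - t) * F x - \<mu> / 2 * t * (1 - t) * D\<^sup>2"
    using F x y t unfolding strongly_convex_def D_def by auto
  ultimately have "t * (F x - (vnorm g + 1) * D + \<mu> / 2 * (1 - t) * D\<^sup>2) \<le> t * F y"
    by (simp add: algebra_simps abs_le_iff)
  then have "F x - (vnorm g + 1) * D + \<mu> / 2 * (1 - t) * D\<^sup>2 \<le> F y" using t by simp
  moreover have "\<mu> / 4 * D\<^sup>2 \<le> \<mu> / 2 * (1 - t) * D\<^sup>2"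
    using t \<mu> by (intro mult_right_mono) (auto simp: field_simps)
  moreover have "(vnorm g + 1) * D \<le> \<mu> / 4 * D\<^sup>2 + (vnorm g + 1)\<^sup>2 / \<mu>"
  proof -
    have "0 \<le> (\<mu> / 2 * D - (vnorm g + 1))\<^sup>2 / \<mu>" using \<mu> by simp
    also have "\<dots> = \<mu> / 4 * D\<^sup>2 + (vnorm g + 1)\<^sup>2 / \<mu> - (vnorm g + 1) * D"
      using \<mu> by (simp add: power2_eq_square field_simps)
    finally show ?thesis by simp
  qed
  ultimately show "F x - (vnorm g + 1)\<^sup>2 / \<mu> \<le> F y" by linarith
qed

text \<open>At the approximate minimizer \<open>u\<close> the gradient \<open>g\<close> is small: comparing with \<open>u - g / M\<close> gives
  \<open>|g|\<^sup>2 \<le> 2 M \<eta>\<close>.\<close>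

lemma smooth_growth:
  assumes F: "smooth d M F" "bdd_below (F ` carrier_vec d)" and M: "M > 0"
    and u: "u \<in> carrier_vec d" "F u \<le> min_val d F + \<eta>" and w: "w \<in> carrier_vec d"
  shows "F w \<le> min_val d F + 2 * \<eta> + M * (vnorm (w - u))\<^sup>2"
proof -
  obtain g where g: "g \<in> carrier_vec d" and up: "\<And>y. y \<in> carrier_vec d \<Longrightarrow>
      F y \<le> F u + scalar_prod g (y - u) + M / 2 * (vnorm (y - u))\<^sup>2"
    using F(1) u unfolding smooth_def has_gradient_def by blast
  let ?y = "u + (- 1 / M) \<cdot>\<^sub>v g"
  have y: "?y \<in> carrier_vec d" "?y - u = (- 1 / M) \<cdot>\<^sub>v g" using u g by auto
  have "min_val d F \<le> F ?y" using F(2) y(1) by (rule min_val_le)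
  also have "\<dots> \<le> F u + scalar_prod g (?y - u) + M / 2 * (vnorm (?y - u))\<^sup>2" by (rule up[OF y(1)])
  also have "\<dots> = F u - (vnorm g)\<^sup>2 / (2 * M)"
    using g M unfolding y(2) vnorm_sq by (simp add: field_simps)
  finally have "(vnorm g)\<^sup>2 / (2 * M) \<le> \<eta>" using u(2) by simp
  \<comment> \<open>Young's inequality, weighted so that the gradient term is the quantity just
    bounded by \<open>\<eta>\<close>; the distance term raises the factor \<open>M / 2\<close> to
    \<open>M\<close>.\<close>
  moreover have "scalar_prod g (w - u) \<le> (vnorm g)\<^sup>2 / (2 * M) + M / 2 * (vnorm (w - u))\<^sup>2"
  proof -
    have "scalar_prod g (w - u) \<le> vnorm g * vnorm (w - u)"
      using scalar_prod_abs_le[OF g, of "w - u"] u w by auto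
    moreover have "0 \<le> (vnorm g - M * vnorm (w - u))\<^sup>2 / (2 * M)" using M by simp
    moreover have "(vnorm g - M * vnorm (w - u))\<^sup>2 / (2 * M)
       = (vnorm g)\<^sup>2 / (2 * M) + M / 2 * (vnorm (w - u))\<^sup>2 - vnorm g * vnorm (w - u)"
      using M by (simp add: power2_eq_square field_simps)
    ultimately show ?thesis by linarith
  qed
  ultimately show ?thesis using up[OF w] u(2) by (simp add: algebra_simps)
qed

subsection \<open>The coordinatewise quadratic inequality\<close>

text \<open>Here \<open>s = 1 / r\<close>, \<open>p = v - y\<close>, \<open>q = u - y\<close>, \<open>e = y - z\<close>, and the factor \<open>\<mu> / 4\<close> is divided
  out; the last summand on the right is nonnegative.\<close>

lemma accel_quadratic_identity:
  fixes r s :: real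
  assumes "r * s = 1"
  shows "(1 - r) * ((s\<^sup>2 - 1) * e\<^sup>2 + s\<^sup>2 * (e - r * p)\<^sup>2 - (s\<^sup>2 - 1) * (r * p)\<^sup>2)
      + r * ((s\<^sup>2 - 1) * e\<^sup>2 + s\<^sup>2 * (q + e)\<^sup>2 - (s\<^sup>2 - 1) * q\<^sup>2)
    = ((1 - r) * p - s * e - q)\<^sup>2 - (1 - r) * (p - q)\<^sup>2
      + ((s\<^sup>2 - 1) * e\<^sup>2 + (1 - r) * r\<^sup>2 * p\<^sup>2 + r * (1 - r) * p\<^sup>2)"
    (is "?lhs = ?rhs")
proof -
  \<comment> \<open>The two sides differ by a multiple of \<open>r * s - 1\<close>, which
    vanishes.\<close>
  have "?lhs - ?rhs = (r * s - 1) * (2 * s * e * (q - (1 - r) * p))"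
    by (simp add: power2_eq_square algebra_simps)
  then show ?thesis using assms by simp
qed

text \<open>Taking \<open>y\<close> as origin expresses everything through \<open>p\<close>,
  \<open>q\<close>, \<open>e\<close>: the extrapolation becomes \<open>x = y - r p\<close> and the
  update \<open>v' = y + (1 - r) p - s e\<close>. The identity above, scaled by
  \<open>\<mu> / 4\<close>, then applies.\<close>

lemma accel_quadratic_le:
  fixes r \<mu> lam x v y z u :: real
  assumes r: "0 < r" "r \<le> 1" and \<mu>: "\<mu> > 0" and lam: "lam > 0" and rr: "r\<^sup>2 * (\<mu> + 2 * lam) = \<mu>"
    and y: "y = 1 / (1 + r) * x + r / (1 + r) * v"
    and v': "v' = (1 - r) * v + r * (y - (2 / \<mu> + 1 / lam) * (lam * (y - z)))"
  shows "\<mu> / 4 * (v' - u)\<^sup>2 - (1 - r) * (\<mu> / 4) * (v - u)\<^sup>2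
    \<le> (1 - r) * (lam / 2 * (z - y)\<^sup>2 + (lam + \<mu> / 2) / 2 * (x - z)\<^sup>2 - lam / 2 * (x - y)\<^sup>2)
      + r * (lam / 2 * (z - y)\<^sup>2 + (lam + \<mu> / 2) / 2 * (u - z)\<^sup>2 - lam / 2 * (u - y)\<^sup>2)"
proof -
  define s where "s = 1 / r"
  define p where "p = v - y"
  define q where "q = u - y"
  define e where "e = y - z"
  have rs: "r * s = 1" using r by (simp add: s_def)
  \<comment> \<open>This says \<open>s\<^sup>2 = \<rho>\<close>.\<close>
  have ls: "\<mu> + 2 * lam = \<mu> * s\<^sup>2" using rr r by (simp add: s_def field_simps power2_eq_square)
  have lam_s: "lam = \<mu> / 2 * (s\<^sup>2 - 1)" using ls by (simp add: field_simps)
  have s1: "s\<^sup>2 \<ge> 1" using r by (simp add: s_def)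
  have "y = (x + r * v) / (1 + r)" unfolding y by (simp add: add_divide_distrib)
  then have "(1 + r) * y = x + r * v" using r by simp
  then have x: "x = y - r * p" by (simp add: p_def algebra_simps)
  \<comment> \<open>The step length satisfies \<open>\<zeta> * lam = \<rho>\<close>, hence
    \<open>r * \<zeta> * lam = s\<close>.\<close>
  have "r * ((2 / \<mu> + 1 / lam) * (lam * e)) = r * ((\<mu> + 2 * lam) / \<mu>) * e"
    using \<mu> lam by (simp add: field_simps)
  also have "\<dots> = s * e" unfolding ls using \<mu> rs by (simp add: power2_eq_square)
  finally have v'e: "v' - y = (1 - r) * p - s * e"
    unfolding v' e_def p_def by (simp add: algebra_simps)
  have d: "v' - u = (1 - r) * p - s * e - q" "v - u = p - q" "z - y = - e" "x - z = e - r * p"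
    "x - y = - (r * p)" "u - z = q + e" "u - y = q"
    using v'e x by (auto simp: p_def q_def e_def)
  have l2: "lam + \<mu> / 2 = \<mu> / 2 * s\<^sup>2" using ls by (simp add: field_simps)
  have "0 \<le> (s\<^sup>2 - 1) * e\<^sup>2 + (1 - r) * r\<^sup>2 * p\<^sup>2 + r * (1 - r) * p\<^sup>2"
    using s1 r by (intro add_nonneg_nonneg mult_nonneg_nonneg) auto
  then have "((1 - r) * p - s * e - q)\<^sup>2 - (1 - r) * (p - q)\<^sup>2
    \<le> (1 - r) * ((s\<^sup>2 - 1) * e\<^sup>2 + s\<^sup>2 * (e - r * p)\<^sup>2 - (s\<^sup>2 - 1) * (r * p)\<^sup>2)
      + r * ((s\<^sup>2 - 1) * e\<^sup>2 + s\<^sup>2 * (q + e)\<^sup>2 - (s\<^sup>2 - 1) * q\<^sup>2)"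
    using accel_quadratic_identity[OF rs, of e p q] by linarith
  then have "\<mu> / 4 * (((1 - r) * p - s * e - q)\<^sup>2 - (1 - r) * (p - q)\<^sup>2)
    \<le> \<mu> / 4 * ((1 - r) * ((s\<^sup>2 - 1) * e\<^sup>2 + s\<^sup>2 * (e - r * p)\<^sup>2 - (s\<^sup>2 - 1) * (r * p)\<^sup>2)
      + r * ((s\<^sup>2 - 1) * e\<^sup>2 + s\<^sup>2 * (q + e)\<^sup>2 - (s\<^sup>2 - 1) * q\<^sup>2))"
    using \<mu> by (intro mult_left_mono) auto
  then show ?thesis
    unfolding d l2 unfolding lam_s
    by (simp add: algebra_simps add_divide_distrib diff_divide_distrib)
qed


subsection \<open>Expectation and running time of timed computations\<close>

text \<open>Working in \<open>ennreal\<close> makes the bind formula free of integrability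
  conditions. Negative values of \<open>f\<close> count as 0, so this is the expectation only where
  \<open>f\<close> is nonnegative on the support.\<close>

definition texp :: "'a timed \<Rightarrow> ('a \<Rightarrow> real) \<Rightarrow> ennreal" where
  "texp m f = (\<integral>\<^sup>+ w. ennreal (f (fst w)) \<partial>measure_pmf m)"

lemma texp_charge [simp]: "texp (charge k a) f = ennreal (f a)"
  by (simp add: texp_def charge_def nn_integral_return)

lemma texp_tbind: "texp (tbind m h) f = (\<integral>\<^sup>+ w. texp (h (fst w)) f \<partial>measure_pmf m)"
  by (simp add: texp_def tbind_def nn_integral_bind_pmf case_prod_unfold)

lemma texp_charge_tbind [simp]: "texp (tbind (charge k a) h) f = texp (h a) f"
  by (simp add: texp_tbind) (simp add: charge_def nn_integral_return)

lemma texp_tbind_charge [simp]: "texp (tbind m (\<lambda>a. charge k (g a))) f = texp m (\<lambda>a. f (g a))"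
  by (simp add: texp_tbind) (simp add: texp_def)

lemma texp_mono:
  assumes "\<And>a. a \<in> fst ` set_pmf m \<Longrightarrow> f a \<le> g a"
  shows "texp m f \<le> texp m g"
  unfolding texp_def using assms
  by (intro nn_integral_mono_AE) (auto simp: AE_measure_pmf_iff intro!: ennreal_leI)

lemma texp_affine:
  assumes "\<And>a. a \<in> fst ` set_pmf m \<Longrightarrow> 0 \<le> f a" and "0 \<le> p" "0 \<le> q"
  shows "texp m (\<lambda>a. p + q * f a) = ennreal p + ennreal q * texp m f"
proof -
  have "texp m (\<lambda>a. p + q * f a)
      = (\<integral>\<^sup>+ w. ennreal p + ennreal q * ennreal (f (fst w)) \<partial>measure_pmf m)"
    unfolding texp_def using assms
    by (intro nn_integral_cong_AE) (auto simp: AE_measure_pmf_iff ennreal_plus ennreal_mult)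
  also have "\<dots> = ennreal p + ennreal q * texp m f"
    by (simp add: texp_def nn_integral_add nn_integral_cmult measure_pmf.emeasure_space_1)
  finally show ?thesis .
qed

lemma texp_le_if_expect_le:
  assumes "expect_le m f B" "\<And>a. a \<in> fst ` set_pmf m \<Longrightarrow> 0 \<le> f a"
  shows "texp m f \<le> ennreal B"
  using assms unfolding texp_def expect_le_def
  by (subst nn_integral_eq_integral) (auto simp: AE_measure_pmf_iff intro!: ennreal_leI)

text \<open>A finite integral of a nonnegative function yields integrability, which
  \<open>expect_le\<close> demands separately.\<close>

lemma expect_le_if_texp_le:
  assumes "texp m f \<le> ennreal B" "0 \<le> B" "\<And>a. a \<in> fst ` set_pmf m \<Longrightarrow> 0 \<le> f a"
  shows "expect_le m f B"
proof -
  have nonneg: "AE w in measure_pmf m. 0 \<le> f (fst w)"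
    using assms(3) by (auto simp: AE_measure_pmf_iff)
  have int: "integrable (measure_pmf m) (\<lambda>w. f (fst w))"
    using assms(1) nonneg unfolding texp_def
    by (intro integrableI_nonneg) (auto simp: top.extremum_strict less_top[symmetric]
        dest: le_less_trans[OF _ ennreal_less_top])
  moreover have "ennreal (measure_pmf.expectation m (\<lambda>w. f (fst w))) \<le> ennreal B"
    using assms(1) unfolding texp_def nn_integral_eq_integral[OF int nonneg] .
  then have "measure_pmf.expectation m (\<lambda>w. f (fst w)) \<le> B"
    using assms(2) by (simp add: ennreal_le_iff)
  ultimately show ?thesis by (simp add: expect_le_def)
qed

lemma fst_set_charge [simp]: "fst ` set_pmf (charge k a) = {a}"
  by (simp add: charge_def)

lemma fst_set_tbind: "fst ` set_pmf (tbind m h) = (\<Union>a\<in>fst ` set_pmf m. fst ` set_pmf (h a))"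
  by (simp add: tbind_def set_bind_pmf image_UN image_image case_prod_unfold)

lemma fst_set_tbind_subset:
  assumes "fst ` set_pmf m \<subseteq> A" "\<And>a. a \<in> A \<Longrightarrow> fst ` set_pmf (h a) \<subseteq> B"
  shows "fst ` set_pmf (tbind m h) \<subseteq> B"
  using assms unfolding fst_set_tbind by blast

lemma time_at_most_charge: "real k \<le> B \<Longrightarrow> time_at_most B (charge k a)"
  by (simp add: time_at_most_def charge_def)

lemma time_at_most_mono: "time_at_most B m \<Longrightarrow> B \<le> B' \<Longrightarrow> time_at_most B' m"
  by (fastforce simp: time_at_most_def)

lemma time_at_most_tbind:
  assumes "time_at_most B m" "\<And>a. a \<in> fst ` set_pmf m \<Longrightarrow> time_at_most B' (h a)"
  shows "time_at_most (B + B') (tbind m h)"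
  unfolding time_at_most_def
proof safe
  fix b t assume "(b, t) \<in> set_pmf (tbind m h)"
  then obtain a i j where aij: "(a, i) \<in> set_pmf m" "(b, j) \<in> set_pmf (h a)" "t = i + j"
    by (auto simp: tbind_def)
  have "a \<in> fst ` set_pmf m" using aij(1) by force
  then have "real j \<le> B'" using assms(2) aij(2) unfolding time_at_most_def by fastforce
  moreover have "real i \<le> B" using assms(1) aij(1) unfolding time_at_most_def by fastforce
  ultimately show "real t \<le> B + B'" using aij(3) by simp
qed

section \<open>Support and running time of accelerated APPA\<close>

context
  fixes d :: nat and F :: "rvec \<Rightarrow> real" and \<mu> lam \<tau> c :: real
    and P :: "rvec \<Rightarrow> rvec timed" and x0 :: rvec
  assumes P: "primal_oracle d F c lam \<tau> P" and x0: "x0 \<in> carrier_vec d"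
begin

lemma appa_step_carrier:
  assumes "x \<in> carrier_vec d" "v \<in> carrier_vec d"
  shows "fst ` set_pmf (appa_step d \<mu> lam P (x, v)) \<subseteq> carrier_vec d \<times> carrier_vec d"
proof -
  have "fst ` set_pmf (P y) \<subseteq> carrier_vec d" if "y \<in> carrier_vec d" for y
    using P that unfolding primal_oracle_def by blast
  then show ?thesis using assms unfolding appa_step_def prod.case Let_def
    by (intro fst_set_tbind_subset[where A = "carrier_vec d"]) auto
qed

lemma appa_state_carrier:
  "fst ` set_pmf (appa_state d \<mu> lam P x0 t) \<subseteq> carrier_vec d \<times> carrier_vec d"
proof (induction t)
  case 0
  then show ?case using x0 by simp
next
  case (Suc t)
  then show ?case unfolding appa_state.simps
    by (rule fst_set_tbind_subset) (use appa_step_carrier in auto)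
qed

lemma accelerated_appa_carrier:
  "fst ` set_pmf (accelerated_appa d \<mu> lam P x0 T) \<subseteq> carrier_vec d"
  unfolding accelerated_appa_def
  by (rule fst_set_tbind_subset[OF appa_state_carrier]) (auto simp: charge_def)

lemma appa_step_time:
  assumes "x \<in> carrier_vec d" "v \<in> carrier_vec d"
  shows "time_at_most (10 * real d + \<tau>) (appa_step d \<mu> lam P (x, v))"
proof -
  have Pt: "time_at_most \<tau> (P y)" if "y \<in> carrier_vec d" for y
    using P that unfolding primal_oracle_def by blast
  have "time_at_most (real (3 * d) + (\<tau> + (real (2 * d) + (real (5 * d) + real 0))))
      (appa_step d \<mu> lam P (x, v))"
    unfolding appa_step_def prod.case Let_def using assms
    by (intro time_at_most_tbind time_at_most_charge Pt) auto
  then show ?thesis by simp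
qed

lemma appa_state_time:
  "time_at_most (real d + 12 + real t * (10 * real d + \<tau>)) (appa_state d \<mu> lam P x0 t)"
proof (induction t)
  case 0
  then show ?case by (simp add: time_at_most_charge)
next
  case (Suc t)
  have "time_at_most (real d + 12 + real t * (10 * real d + \<tau>) + (10 * real d + \<tau>))
      (appa_state d \<mu> lam P x0 (Suc t))"
    unfolding appa_state.simps using appa_state_carrier[of t]
    by (intro time_at_most_tbind Suc.IH) (auto intro: appa_step_time)
  then show ?case by (simp add: algebra_simps)
qed

lemma accelerated_appa_time:
  "time_at_most (real d + 12 + real T * (10 * real d + \<tau>)) (accelerated_appa d \<mu> lam P x0 T)"
proof -
  have "time_at_most (real d + 12 + real T * (10 * real d + \<tau>) + 0)
      (accelerated_appa d \<mu> lam P x0 T)"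
    unfolding accelerated_appa_def
    by (intro time_at_most_tbind appa_state_time) (auto intro: time_at_most_charge)
  then show ?thesis by simp
qed

end

text \<open>The oracle call is the only random part of an iteration, so the expectation reduces to
  one over the oracle output \<open>z\<close>.\<close>

lemma texp_appa_step:
  fixes \<mu> lam :: real
  defines "r \<equiv> appa_rho \<mu> lam powr (- 1 / 2)"
  defines "y \<equiv> \<lambda>x v. 1 / (1 + r) \<cdot>\<^sub>v x + r / (1 + r) \<cdot>\<^sub>v v"
  shows "texp (appa_step d \<mu> lam P (x, v)) f = texp (P (y x v)) (\<lambda>z. f (z,
    (1 - r) \<cdot>\<^sub>v v + r \<cdot>\<^sub>v (y x v - (2 / \<mu> + 1 / lam) \<cdot>\<^sub>v (lam \<cdot>\<^sub>v (y x v - z)))))"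
  unfolding appa_step_def prod.case Let_def texp_charge_tbind r_def y_def
  by (subst texp_tbind, unfold texp_charge_tbind texp_charge) (simp add: texp_def)

subsection \<open>Convergence of accelerated APPA\<close>

text \<open>The weight \<open>\<mu> / 4\<close> is half of the curvature \<open>\<mu> / 2\<close>
  left in the lower bound on \<open>F\<close>; the reference point \<open>u\<close> stands in for a
  minimizer.\<close>

definition appa_potential :: "nat \<Rightarrow> (rvec \<Rightarrow> real) \<Rightarrow> real \<Rightarrow> rvec \<Rightarrow> rvec \<times> rvec \<Rightarrow> real" where
  "appa_potential d F \<mu> u = (\<lambda>(x, v). F x - min_val d F + \<mu> / 4 * (vnorm (v - u))\<^sup>2)"

context
  fixes d :: nat and F :: "rvec \<Rightarrow> real" and \<mu> lam :: real
  assumes sc: "strongly_convex d \<mu> F" and bdd: "bdd_below (F ` carrier_vec d)"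
    and \<mu>: "\<mu> > 0" and lam: "lam > 0"
begin

lemma appa_potential_nonneg:
  "s \<in> carrier_vec d \<times> carrier_vec d \<Longrightarrow> 0 \<le> appa_potential d F \<mu> u s"
  using min_val_le[OF bdd] \<mu> by (auto simp: appa_potential_def)

lemma prox_obj_ge: "s \<in> carrier_vec d \<Longrightarrow> x \<in> carrier_vec d \<Longrightarrow> min_val d F \<le> prox_obj F s lam x"
  using min_val_le[OF bdd, of x] lam unfolding prox_obj_def by (simp add: add_increasing2)

lemma bdd_below_prox_obj: "s \<in> carrier_vec d \<Longrightarrow> bdd_below (prox_obj F s lam ` carrier_vec d)"
  by (rule bdd_belowI2[of _ "min_val d F"]) (rule prox_obj_ge)

lemma min_val_prox_obj_ge: "s \<in> carrier_vec d \<Longrightarrow> min_val d F \<le> min_val d (prox_obj F s lam)"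
  unfolding min_val_def[of d "prox_obj F s lam"]
  by (rule cINF_greatest) (auto intro: prox_obj_ge zero_carrier_vec)

text \<open>The convexity parameter \<open>t = 1 / (1 + \<rho>)\<close> trades half of the strong convexity of \<open>F\<close> for
  replacing the minimizer of the regularized problem by the approximate one \<open>z\<close>.\<close>

lemma prox_lower_bound:
  assumes y: "y \<in> carrier_vec d" and z: "z \<in> carrier_vec d" and w: "w \<in> carrier_vec d"
  shows "F z + (lam / 2 * (vnorm (z - y))\<^sup>2 + (lam + \<mu> / 2) / 2 * (vnorm (w - z))\<^sup>2
      - lam / 2 * (vnorm (w - y))\<^sup>2)
    - (1 + appa_rho \<mu> lam) * (prox_obj F y lam z - min_val d (prox_obj F y lam)) \<le> F w"
proof -
  let ?\<rho> = "appa_rho \<mu> lam"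
  have \<rho>: "?\<rho> > 0" using \<mu> lam by (simp add: appa_rho_def)
  have "prox_obj F y lam z + (\<mu> + lam) / 2 * (1 - 1 / (1 + ?\<rho>)) * (vnorm (w - z))\<^sup>2
      - (prox_obj F y lam z - min_val d (prox_obj F y lam)) / (1 / (1 + ?\<rho>)) \<le> prox_obj F y lam w"
    using \<rho> y z w by (intro strongly_convex_gap strongly_convex_prox_obj sc bdd_below_prox_obj) auto
  \<comment> \<open>Since \<open>1 / (1 + \<rho>)\<close> equals
    \<open>\<mu> / (2 * (\<mu> + lam))\<close>, exactly \<open>\<mu> / 2\<close> of the curvature
    \<open>\<mu> + lam\<close> is given up.\<close>
  moreover have "(\<mu> + lam) / 2 * (1 - 1 / (1 + ?\<rho>)) = (lam + \<mu> / 2) / 2"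
  proof -
    have "1 + ?\<rho> = 2 * (\<mu> + lam) / \<mu>" using \<mu> by (simp add: appa_rho_def field_simps)
    then show ?thesis using \<mu> lam by (simp only:) (simp add: field_simps)
  qed
  moreover define X where
    "X = (1 + ?\<rho>) * (prox_obj F y lam z - min_val d (prox_obj F y lam))"
  then have "(prox_obj F y lam z - min_val d (prox_obj F y lam)) / (1 / (1 + ?\<rho>)) = X" by simp
  ultimately have "prox_obj F y lam z + (lam + \<mu> / 2) / 2 * (vnorm (w - z))\<^sup>2 - X
      \<le> prox_obj F y lam w" by simp
  then show ?thesis unfolding X_def[symmetric] by (simp add: prox_obj_def)
qed

text \<open>The updates act coordinatewise and squared norms are sums of squares, so the scalar
  inequality is summed over the coordinates.\<close>

lemma vnorm_carrier_quadratic_le: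
  fixes r :: real
  assumes r: "0 < r" "r \<le> 1" and rr: "r\<^sup>2 * (\<mu> + 2 * lam) = \<mu>"
    and c: "x \<in> carrier_vec d" "v \<in> carrier_vec d" "z \<in> carrier_vec d" "u \<in> carrier_vec d"
  defines "y \<equiv> 1 / (1 + r) \<cdot>\<^sub>v x + r / (1 + r) \<cdot>\<^sub>v v"
  defines "v' \<equiv> (1 - r) \<cdot>\<^sub>v v + r \<cdot>\<^sub>v (y - (2 / \<mu> + 1 / lam) \<cdot>\<^sub>v (lam \<cdot>\<^sub>v (y - z)))"
  shows "\<mu> / 4 * (vnorm (v' - u))\<^sup>2 - (1 - r) * (\<mu> / 4) * (vnorm (v - u))\<^sup>2
    \<le> (1 - r) * (lam / 2 * (vnorm (z - y))\<^sup>2 + (lam + \<mu> / 2) / 2 * (vnorm (x - z))\<^sup>2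
          - lam / 2 * (vnorm (x - y))\<^sup>2)
      + r * (lam / 2 * (vnorm (z - y))\<^sup>2 + (lam + \<mu> / 2) / 2 * (vnorm (u - z))\<^sup>2
          - lam / 2 * (vnorm (u - y))\<^sup>2)"
proof -
  have y: "y \<in> carrier_vec d" and v': "v' \<in> carrier_vec d" using c by (auto simp: y_def v'_def)
  let ?i = "\<lambda>w i. vec_index (w :: rvec) i"
  have "(\<Sum>i<d. \<mu> / 4 * (?i v' i - ?i u i)\<^sup>2 - (1 - r) * (\<mu> / 4) * (?i v i - ?i u i)\<^sup>2)
    \<le> (\<Sum>i<d. (1 - r) * (lam / 2 * (?i z i - ?i y i)\<^sup>2 + (lam + \<mu> / 2) / 2 * (?i x i - ?i z i)\<^sup>2
          - lam / 2 * (?i x i - ?i y i)\<^sup>2)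
      + r * (lam / 2 * (?i z i - ?i y i)\<^sup>2 + (lam + \<mu> / 2) / 2 * (?i u i - ?i z i)\<^sup>2
          - lam / 2 * (?i u i - ?i y i)\<^sup>2))"
  proof (rule sum_mono)
    fix i assume i: "i \<in> {..<d}"
    have yi: "?i y i = 1 / (1 + r) * ?i x i + r / (1 + r) * ?i v i"
      using c i by (simp add: y_def)
    have "?i v' i = (1 - r) * ?i v i
        + r * (?i y i - (2 / \<mu> + 1 / lam) * (lam * (?i y i - ?i z i)))"
      using c i y by (simp add: v'_def)
    then show "\<mu> / 4 * (?i v' i - ?i u i)\<^sup>2 - (1 - r) * (\<mu> / 4) * (?i v i - ?i u i)\<^sup>2
      \<le> (1 - r) * (lam / 2 * (?i z i - ?i y i)\<^sup>2 + (lam + \<mu> / 2) / 2 * (?i x i - ?i z i)\<^sup>2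
          - lam / 2 * (?i x i - ?i y i)\<^sup>2)
      + r * (lam / 2 * (?i z i - ?i y i)\<^sup>2 + (lam + \<mu> / 2) / 2 * (?i u i - ?i z i)\<^sup>2
          - lam / 2 * (?i u i - ?i y i)\<^sup>2)"
      by (intro accel_quadratic_le r \<mu> lam rr yi)
  qed
  then show ?thesis
    using c y v' by (simp add: vnorm_diff_sq[of _ d] sum.distrib sum_subtractf 
        flip: sum_distrib_left sum_divide_distrib)
qed

context
  fixes M c \<tau> \<eta> :: real and P :: "rvec \<Rightarrow> rvec timed" and u :: rvec
  assumes M: "M > 0" and smooth: "smooth d M F" and P: "primal_oracle d F c lam \<tau> P"
    and c: "4 * appa_rho \<mu> lam powr (3 / 2) * (1 + 4 * M / \<mu>) \<le> c"
    and \<eta>: "\<eta> > 0" and u: "u \<in> carrier_vec d" "F u \<le> min_val d F + \<eta>"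
begin

abbreviation (input) rate :: real where "rate \<equiv> appa_rho \<mu> lam powr (- 1 / 2)"

text \<open>With \<open>K = 1 + 4 * M / \<mu>\<close>, the accuracy bounds follow from
  \<open>1 + \<rho> \<le> 2 \<rho>\<close> and \<open>\<rho> = \<rho> powr (3/2) * rate\<close>:
  then \<open>(1 + \<rho>) K \<le> c * rate / 2\<close>. The bound with factor 2 uses
  \<open>K \<ge> 1\<close> and \<open>rate \<le> 1\<close>.\<close>

lemma rate: "0 < rate" "rate \<le> 1" "rate\<^sup>2 * (\<mu> + 2 * lam) = \<mu>"
  "(1 + appa_rho \<mu> lam) / c * (1 + 4 * M / \<mu>) \<le> rate / 2"
  "(1 + appa_rho \<mu> lam) / c * 2 \<le> 1" "0 < c"
proof -
  let ?\<rho> = "appa_rho \<mu> lam"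
  have \<rho>: "?\<rho> \<ge> 1" using \<mu> lam by (simp add: appa_rho_def field_simps)
  then show r: "0 < rate" by simp
  have "?\<rho> powr (- 1 / 2) \<le> ?\<rho> powr 0" using \<rho> by (intro powr_mono) auto
  then show r1: "rate \<le> 1" using \<rho> by simp
  have "rate\<^sup>2 = ?\<rho> powr (- 1)"
    unfolding power2_eq_square powr_add[symmetric] by simp
  then have "rate\<^sup>2 = 1 / ?\<rho>" using \<rho> by (simp add: powr_minus divide_simps)
  then show "rate\<^sup>2 * (\<mu> + 2 * lam) = \<mu>" using \<mu> lam by (simp add: appa_rho_def)
  define K where "K = 1 + 4 * M / \<mu>"
  have K: "K \<ge> 1" using M \<mu> by (simp add: K_def)
  have p: "?\<rho> powr (3 / 2) * rate = ?\<rho>" using \<rho> by (simp add: powr_add[symmetric])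
  have "0 < 4 * ?\<rho> powr (3 / 2) * K" using \<rho> K by simp
  then show c0: "0 < c" unfolding K_def by (rule less_le_trans[OF _ c])
  have "(1 + ?\<rho>) * K \<le> 2 * ?\<rho> * K" using \<rho> K by (intro mult_right_mono) auto
  also have "\<dots> = 4 * ?\<rho> powr (3 / 2) * K * rate / 2" using p by (simp add: algebra_simps)
  also have "\<dots> \<le> c * rate / 2"
    unfolding K_def by (intro divide_right_mono mult_right_mono c less_imp_le[OF r]) simp
  finally have le: "(1 + ?\<rho>) / c * K \<le> rate / 2" using c0 by (simp add: field_simps)
  then show "(1 + ?\<rho>) / c * (1 + 4 * M / \<mu>) \<le> rate / 2" by (simp add: K_def)
  have "(1 + ?\<rho>) / c * 1 \<le> (1 + ?\<rho>) / c * K" using K c0 \<rho> by (intro mult_left_mono) auto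
  also note le
  also have "rate / 2 \<le> 1 / 2" using r1 by simp
  finally show "(1 + ?\<rho>) / c * 2 \<le> 1" by simp
qed

text \<open>By convexity \<open>F y\<close> is at most the weighted mean of \<open>F x\<close> and
  \<open>F v\<close>. Smoothness around \<open>u\<close> bounds \<open>F v\<close>, and
  \<open>M |v - u|^2\<close> is \<open>4 M / \<mu>\<close> times the distance term of the
  potential.\<close>

lemma extrapolation_gap_le:
  assumes x: "x \<in> carrier_vec d" and v: "v \<in> carrier_vec d"
  defines "y \<equiv> 1 / (1 + rate) \<cdot>\<^sub>v x + rate / (1 + rate) \<cdot>\<^sub>v v"
  shows "F y - min_val d F \<le> (1 + 4 * M / \<mu>) * appa_potential d F \<mu> u (x, v) + 2 * \<eta>"
proof -
  let ?t = "1 / (1 + rate)"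
  have t: "0 \<le> ?t" "?t \<le> 1" "1 - ?t = rate / (1 + rate)" 
  proof -
    have "0 < 1 + rate" using rate(1) by linarith
    then show "0 \<le> ?t" "?t \<le> 1" "1 - ?t = rate / (1 + rate)"
      using rate(1) by (simp_all add: diff_divide_eq_iff del: powr_gt_zero)
  qed
  let ?g = "F x - min_val d F"
  let ?n = "(vnorm (v - u))\<^sup>2"
  have g: "0 \<le> ?g" using min_val_le[OF bdd x] by simp
  have "F y \<le> ?t * F x + (1 - ?t) * F v - \<mu> / 2 * ?t * (1 - ?t) * (vnorm (x - v))\<^sup>2"
    unfolding y_def t(3)[symmetric]
    using sc[unfolded strongly_convex_def, rule_format, OF x v, of ?t] t(1,2) by simp
  also have "\<dots> \<le> ?t * F x + (1 - ?t) * F v" using t(1,2) \<mu> by simp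
  also have "\<dots> \<le> ?t * F x + (1 - ?t) * (min_val d F + 2 * \<eta> + M * ?n)"
    using t smooth_growth[OF smooth bdd M u v] by (intro add_left_mono mult_left_mono) auto
  also have "\<dots> = min_val d F + ?t * ?g + (1 - ?t) * (2 * \<eta> + M * ?n)"
    by (simp add: algebra_simps diff_divide_distrib)
  also have "\<dots> \<le> min_val d F + 1 * ?g + 1 * (2 * \<eta> + M * ?n)"
  proof (intro add_mono mult_right_mono t(2) g order_refl)
    show "1 - ?t \<le> 1" using t(1) by linarith
    show "0 \<le> 2 * \<eta> + M * ?n" using \<eta> M by simp
  qed
  also have "\<dots> \<le> min_val d F + (1 + 4 * M / \<mu>) * (?g + \<mu> / 4 * ?n) + 2 * \<eta>"
  proof -
    define X where "X = 4 * M / \<mu> * ?g + \<mu> / 4 * ?n"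
    have eq: "(1 + 4 * M / \<mu>) * (?g + \<mu> / 4 * ?n) = ?g + M * ?n + X"
      using \<mu> by (simp add: X_def field_simps)
    have nn: "0 \<le> X" using g M \<mu> by (simp add: X_def)
    show ?thesis by (subst eq) (use nn in simp)
  qed
  finally show ?thesis by (simp add: appa_potential_def)
qed

text \<open>Half of the contraction \<open>rate\<close> pays for the oracle error. One
  \<open>\<eta>\<close> comes from using \<open>u\<close> as reference point, the other from the gap
  at \<open>y\<close>.\<close>

lemma appa_step_decrease:
  assumes x: "x \<in> carrier_vec d" and v: "v \<in> carrier_vec d"
  shows "texp (appa_step d \<mu> lam P (x, v)) (appa_potential d F \<mu> u)
    \<le> ennreal ((1 - rate / 2) * appa_potential d F \<mu> u (x, v) + 2 * \<eta>)"
proof -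
  let ?\<rho> = "appa_rho \<mu> lam"
  let ?\<Phi> = "appa_potential d F \<mu> u"
  define y where "y = 1 / (1 + rate) \<cdot>\<^sub>v x + rate / (1 + rate) \<cdot>\<^sub>v v"
  define v' where "v' = (\<lambda>z. (1 - rate) \<cdot>\<^sub>v v
      + rate \<cdot>\<^sub>v (y - (2 / \<mu> + 1 / lam) \<cdot>\<^sub>v (lam \<cdot>\<^sub>v (y - z))))"
  define gap where "gap = (\<lambda>z. prox_obj F y lam z - min_val d (prox_obj F y lam))"
  have y: "y \<in> carrier_vec d" using x v by (simp add: y_def)
  have \<rho>: "?\<rho> \<ge> 0" using \<mu> lam by (simp add: appa_rho_def)
  have supp: "z \<in> carrier_vec d" if "z \<in> fst ` set_pmf (P y)" for z
    using P y that unfolding primal_oracle_def by blast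
  have gap0: "0 \<le> gap z" if "z \<in> carrier_vec d" for z
    using min_val_le[OF bdd_below_prox_obj[OF y] that] by (simp add: gap_def)
  have \<Phi>0: "0 \<le> ?\<Phi> (x, v)" using x v by (intro appa_potential_nonneg) auto
  define K where "K = (1 - rate) * ?\<Phi> (x, v) + rate * \<eta>"
  have K: "0 \<le> K" using rate(1,2) \<Phi>0 \<eta> by (simp add: K_def)
  \<comment> \<open>This holds for every oracle output, before taking expectations.
    \<open>A w\<close> is the quadratic part of the lower bound, used at \<open>x\<close> with
    weight \<open>1 - rate\<close> and at \<open>u\<close> with weight \<open>rate\<close>.\<close>
  have pw: "?\<Phi> (z, v' z) \<le> K + (1 + ?\<rho>) * gap z" if z: "z \<in> carrier_vec d" for z
  proof -
    define A where "A = (\<lambda>w. lam / 2 * (vnorm (z - y))\<^sup>2 + (lam + \<mu> / 2) / 2 * (vnorm (w - z))\<^sup>2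
      - lam / 2 * (vnorm (w - y))\<^sup>2)"
    have "\<mu> / 4 * (vnorm (v' z - u))\<^sup>2 - (1 - rate) * (\<mu> / 4) * (vnorm (v - u))\<^sup>2
        \<le> (1 - rate) * A x + rate * A u"
      unfolding A_def v'_def y_def by (intro vnorm_carrier_quadratic_le rate x v z u)
    moreover have "F z + A w - (1 + ?\<rho>) * gap z \<le> F w" if "w \<in> carrier_vec d" for w
      unfolding A_def gap_def by (rule prox_lower_bound[OF y z that])
    then have "A w \<le> F w - F z + (1 + ?\<rho>) * gap z" if "w \<in> carrier_vec d" for w
      using that by fastforce
    then have "(1 - rate) * A x + rate * A u \<le> (1 - rate) * (F x - F z + (1 + ?\<rho>) * gap z)
        + rate * (F u - F z + (1 + ?\<rho>) * gap z)"
      using rate(1,2) x u(1) by (intro add_mono mult_left_mono) auto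
    moreover have "(1 - rate) * (F x - F z + (1 + ?\<rho>) * gap z) + rate * (F u - F z + (1 + ?\<rho>) * gap z)
        = (1 - rate) * F x + rate * F u - F z + (1 + ?\<rho>) * gap z" by (simp add: algebra_simps)
    moreover have "rate * F u \<le> rate * (min_val d F + \<eta>)" using u rate(1) by simp
    ultimately show ?thesis 
      by (simp add: K_def appa_potential_def algebra_simps add_divide_distrib diff_divide_distrib)
  qed
  have "texp (appa_step d \<mu> lam P (x, v)) ?\<Phi> = texp (P y) (\<lambda>z. ?\<Phi> (z, v' z))"
    unfolding texp_appa_step y_def v'_def ..
  also have "\<dots> \<le> texp (P y) (\<lambda>z. K + (1 + ?\<rho>) * gap z)"
    by (intro texp_mono pw supp)
  also have "\<dots> = ennreal K + ennreal (1 + ?\<rho>) * texp (P y) gap"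
    using K \<rho> by (intro texp_affine gap0 supp) auto
  also have "texp (P y) gap \<le> ennreal (1 / c * gap y)"
    using P y unfolding primal_oracle_def gap_def
    by (intro texp_le_if_expect_le gap0[unfolded gap_def] supp) auto
  also have "ennreal K + ennreal (1 + ?\<rho>) * ennreal (1 / c * gap y)
      = ennreal (K + (1 + ?\<rho>) / c * gap y)"
    using K \<rho> gap0[OF y] rate(6) by (simp add: ennreal_mult[symmetric] ennreal_plus[symmetric] del: ennreal_plus)
  also have "\<dots> \<le> ennreal ((1 - rate / 2) * ?\<Phi> (x, v) + 2 * \<eta>)"
  proof (rule ennreal_leI)
    \<comment> \<open>At its center \<open>y\<close> the regularizer vanishes, and regularizing
      cannot lower the infimum, so the gap before the oracle call is at most that of
      \<open>F\<close>.\<close>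
    have "vnorm (y - y) = 0" using y by (simp add: vnorm_def)
    then have "gap y \<le> F y - min_val d F"
      using min_val_prox_obj_ge[OF y] by (simp add: gap_def prox_obj_def)
    also have "\<dots> \<le> (1 + 4 * M / \<mu>) * ?\<Phi> (x, v) + 2 * \<eta>"
      unfolding y_def by (rule extrapolation_gap_le[OF x v])
    finally have "(1 + ?\<rho>) / c * gap y \<le> (1 + ?\<rho>) / c * ((1 + 4 * M / \<mu>) * ?\<Phi> (x, v) + 2 * \<eta>)"
      using \<rho> rate(6) by (intro mult_left_mono) auto
    also have "\<dots> = (1 + ?\<rho>) / c * (1 + 4 * M / \<mu>) * ?\<Phi> (x, v) + (1 + ?\<rho>) / c * 2 * \<eta>"
      by (simp add: algebra_simps)
    also have "\<dots> \<le> rate / 2 * ?\<Phi> (x, v) + 1 * \<eta>"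
      using rate(4,5) \<Phi>0 \<eta> by (intro add_mono mult_right_mono) auto
    finally have "(1 + ?\<rho>) / c * gap y \<le> rate / 2 * ?\<Phi> (x, v) + 1 * \<eta>" .
    moreover have "K \<le> (1 - rate) * ?\<Phi> (x, v) + 1 * \<eta>"
      unfolding K_def using \<eta> by (intro add_left_mono mult_right_mono rate(2)) simp
    ultimately show "K + (1 + ?\<rho>) / c * gap y \<le> (1 - rate / 2) * ?\<Phi> (x, v) + 2 * \<eta>"
      by (simp add: algebra_simps)
  qed
  finally show ?thesis by (simp add: add_left_mono mult_left_mono)
qed

text \<open>The error \<open>2 * \<eta>\<close> of each step is accumulated without damping; linear
  growth in \<open>t\<close> is harmless because \<open>\<eta>\<close> is later sent to 0 for a
  fixed number of steps.\<close>

lemma appa_state_potential: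
  assumes x0: "x0 \<in> carrier_vec d"
  shows "texp (appa_state d \<mu> lam P x0 t) (appa_potential d F \<mu> u)
    \<le> ennreal ((1 - rate / 2) ^ t * appa_potential d F \<mu> u (x0, x0) + 2 * \<eta> * real t)"
proof (induction t)
  case 0
  then show ?case by simp
next
  case (Suc t)
  let ?\<Phi> = "appa_potential d F \<mu> u"
  let ?m = "appa_state d \<mu> lam P x0 t"
  note supp = subsetD[OF appa_state_carrier[OF P x0]]
  have h: "0 \<le> 1 - rate / 2" "1 - rate / 2 \<le> 1" using rate(1,2) by auto
  have \<Phi>0: "0 \<le> ?\<Phi> (x0, x0)" using x0 by (intro appa_potential_nonneg) auto
  have "texp (appa_state d \<mu> lam P x0 (Suc t)) ?\<Phi>
      \<le> texp ?m (\<lambda>s. 2 * \<eta> + (1 - rate / 2) * ?\<Phi> s)"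
    unfolding appa_state.simps texp_tbind unfolding texp_def[of ?m]
  proof (intro nn_integral_mono_AE, unfold AE_measure_pmf_iff, intro ballI)
    fix w assume "w \<in> set_pmf ?m"
    then have "fst w \<in> carrier_vec d \<times> carrier_vec d" by (intro supp imageI)
    then show "texp (appa_step d \<mu> lam P (fst w)) ?\<Phi>
        \<le> ennreal (2 * \<eta> + (1 - rate / 2) * ?\<Phi> (fst w))"
      using appa_step_decrease[of "fst (fst w)" "snd (fst w)"] by (auto simp: add.commute)
  qed
  also have "\<dots> = ennreal (2 * \<eta>) + ennreal (1 - rate / 2) * texp ?m ?\<Phi>"
    using \<eta> h by (intro texp_affine appa_potential_nonneg supp) auto
  also have "\<dots> \<le> ennreal (2 * \<eta>) + ennreal (1 - rate / 2)
      * ennreal ((1 - rate / 2) ^ t * ?\<Phi> (x0, x0) + 2 * \<eta> * real t)"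
    by (intro add_left_mono mult_left_mono Suc.IH) auto
  also have "\<dots> = ennreal (2 * \<eta> + (1 - rate / 2) * ((1 - rate / 2) ^ t * ?\<Phi> (x0, x0) + 2 * \<eta> * real t))"
    using h \<eta> \<Phi>0 by (subst ennreal_mult[symmetric]) (auto simp: ennreal_plus[symmetric] simp del: ennreal_plus)
  also have "\<dots> \<le> ennreal ((1 - rate / 2) ^ Suc t * ?\<Phi> (x0, x0) + 2 * \<eta> * real (Suc t))"
  proof (rule ennreal_leI)
    have "(1 - rate / 2) * (2 * \<eta> * real t) \<le> 1 * (2 * \<eta> * real t)"
      using h \<eta> by (intro mult_right_mono) auto
    then show "2 * \<eta> + (1 - rate / 2) * ((1 - rate / 2) ^ t * ?\<Phi> (x0, x0) + 2 * \<eta> * real t)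
        \<le> (1 - rate / 2) ^ Suc t * ?\<Phi> (x0, x0) + 2 * \<eta> * real (Suc t)"
      by (simp add: algebra_simps)
  qed
  finally show ?case .
qed

lemma accelerated_appa_near_min:
  assumes x0: "x0 \<in> carrier_vec d"
  shows "texp (accelerated_appa d \<mu> lam P x0 T) (\<lambda>x. F x - min_val d F)
    \<le> ennreal ((1 - rate / 2) ^ T * (2 * (F x0 - min_val d F)) + \<eta> * (1 + 2 * real T))"
proof -
  let ?m = "appa_state d \<mu> lam P x0 T"
  have "texp (accelerated_appa d \<mu> lam P x0 T) (\<lambda>x. F x - min_val d F)
      = texp ?m (\<lambda>s. F (fst s) - min_val d F)"
    unfolding accelerated_appa_def case_prod_unfold by simp
  also have "\<dots> \<le> texp ?m (appa_potential d F \<mu> u)"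
    using \<mu> by (intro texp_mono) (auto simp: appa_potential_def)
  also have "\<dots> \<le> ennreal ((1 - rate / 2) ^ T * appa_potential d F \<mu> u (x0, x0) + 2 * \<eta> * real T)"
    by (rule appa_state_potential[OF x0])
  also have "\<dots> \<le> ennreal ((1 - rate / 2) ^ T * (2 * (F x0 - min_val d F)) + \<eta> * (1 + 2 * real T))"
  proof (rule ennreal_leI)
    \<comment> \<open>The choice \<open>t = 1 / 2\<close> yields the weight \<open>\<mu> / 4\<close>
      of the potential, so the initial potential is at most twice the initial gap plus
      \<open>\<eta>\<close>.\<close>
    have "F u + \<mu> / 2 * (1 - 1 / 2) * (vnorm (x0 - u))\<^sup>2 - (F u - min_val d F) / (1 / 2) \<le> F x0"
      using x0 u by (intro strongly_convex_gap sc bdd) auto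
    then have "appa_potential d F \<mu> u (x0, x0) \<le> 2 * (F x0 - min_val d F) + \<eta>"
      using u(2) by (simp add: appa_potential_def)
    then have "(1 - rate / 2) ^ T * appa_potential d F \<mu> u (x0, x0)
        \<le> (1 - rate / 2) ^ T * (2 * (F x0 - min_val d F) + \<eta>)"
      using rate(1,2) by (intro mult_left_mono) auto
    moreover have "(1 - rate / 2) ^ T * \<eta> \<le> 1 * \<eta>"
      using rate(1,2) \<eta> by (intro mult_right_mono power_le_one) auto
    ultimately show "(1 - rate / 2) ^ T * appa_potential d F \<mu> u (x0, x0) + 2 * \<eta> * real T
        \<le> (1 - rate / 2) ^ T * (2 * (F x0 - min_val d F)) + \<eta> * (1 + 2 * real T)"
      by (simp add: algebra_simps)
  qed
  finally show ?thesis .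
qed

end

text \<open>The run does not depend on \<open>u\<close>. For fixed \<open>T\<close> the
  near-minimizer can therefore be chosen after the run, making the \<open>\<eta>\<close> term
  arbitrarily small.\<close>

lemma accelerated_appa_converges:
  assumes M: "M > 0" "smooth d M F" and P: "primal_oracle d F c lam \<tau> P"
    and c: "4 * appa_rho \<mu> lam powr (3 / 2) * (1 + 4 * M / \<mu>) \<le> c"
    and x0: "x0 \<in> carrier_vec d"
  shows "expect_le (accelerated_appa d \<mu> lam P x0 T) (\<lambda>x. F x - min_val d F)
    ((1 - appa_rho \<mu> lam powr (- 1 / 2) / 2) ^ T * (2 * (F x0 - min_val d F)))"
proof (rule expect_le_if_texp_le)
  let ?r = "appa_rho \<mu> lam powr (- 1 / 2)"
  have "?r \<le> appa_rho \<mu> lam powr 0"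
    using \<mu> lam by (intro powr_mono) (auto simp: appa_rho_def field_simps)
  then have r: "?r \<le> 1" using \<mu> lam by (simp add: appa_rho_def)
  show B: "0 \<le> (1 - ?r / 2) ^ T * (2 * (F x0 - min_val d F))"
    using r min_val_le[OF bdd x0] by simp
  show "0 \<le> F a - min_val d F" if "a \<in> fst ` set_pmf (accelerated_appa d \<mu> lam P x0 T)" for a
    using accelerated_appa_carrier[OF P x0] min_val_le[OF bdd] that by (simp add: subset_iff)
  show "texp (accelerated_appa d \<mu> lam P x0 T) (\<lambda>x. F x - min_val d F)
      \<le> ennreal ((1 - ?r / 2) ^ T * (2 * (F x0 - min_val d F)))"
  proof (rule ennreal_le_epsilon)
    fix e :: real assume e: "0 < e"
    \<comment> \<open>Chosen so that the total error \<open>\<eta> * (1 + 2 * T)\<close> is exactly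
      \<open>e\<close>.\<close>
    define \<eta> where "\<eta> = e / (1 + 2 * real T)"
    have \<eta>: "\<eta> > 0" "\<eta> * (1 + 2 * real T) = e" using e by (auto simp: \<eta>_def add_pos_nonneg)
    have "(INF x\<in>carrier_vec d. F x) < min_val d F + \<eta>" using \<eta>(1) by (simp add: min_val_def)
    then obtain u where u: "u \<in> carrier_vec d" "F u < min_val d F + \<eta>"
      using cINF_less_iff[OF _ bdd] x0 by blast
    have "texp (accelerated_appa d \<mu> lam P x0 T) (\<lambda>x. F x - min_val d F)
        \<le> ennreal ((1 - ?r / 2) ^ T * (2 * (F x0 - min_val d F)) + e)"
      using accelerated_appa_near_min[OF M P c \<eta>(1) u(1) less_imp_le[OF u(2)] x0, of T]
      unfolding \<eta>(2) .
    also have "\<dots> = ennreal ((1 - ?r / 2) ^ T * (2 * (F x0 - min_val d F))) + ennreal e"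
      using B e by (intro ennreal_plus) auto
    finally show "texp (accelerated_appa d \<mu> lam P x0 T) (\<lambda>x. F x - min_val d F)
        \<le> ennreal ((1 - ?r / 2) ^ T * (2 * (F x0 - min_val d F))) + ennreal e" .
  qed
qed

end


subsection \<open>Choice of the oracle accuracy and the number of iterations\<close>

text \<open>The last factor absorbs \<open>F v - min F\<close> at the extrapolation point, which the potential controls
  only through the smoothness constant \<open>n L R\<^sup>2\<close> of \<open>F\<close>.\<close>

definition appa_accuracy :: "nat \<Rightarrow> real \<Rightarrow> real \<Rightarrow> real \<Rightarrow> real" where
  "appa_accuracy n \<mu> L R = 4 * appa_rho \<mu> (2 * \<mu> + L * R\<^sup>2) powr (3 / 2)
     * (1 + 4 * (real n * (L * R\<^sup>2)) / \<mu>)"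

text \<open>The argument \<open>x\<close> is the ratio of initial to target accuracy. The factor
  \<open>2 * sqrt \<rho>\<close> is the inverse of the contraction \<open>rate / 2\<close>, and
  \<open>2 * x\<close> compensates the factor 2 before the initial gap.\<close>

definition appa_iterations :: "nat \<Rightarrow> real \<Rightarrow> real \<Rightarrow> real \<Rightarrow> real \<Rightarrow> nat" where
  "appa_iterations n \<mu> L R x = nat \<lceil>2 * sqrt (appa_rho \<mu> (2 * \<mu> + L * R\<^sup>2)) * ln (2 * x)\<rceil>"

context
  fixes n :: nat and \<mu> L R :: real
  assumes n: "1 \<le> n" and \<mu>: "0 < \<mu>" and L: "0 < L" and R: "0 < R"
begin

lemma appa_rho_eq: "appa_rho \<mu> (2 * \<mu> + L * R\<^sup>2) = 5 + 2 * (L * R\<^sup>2 / \<mu>)"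
  using \<mu> by (simp add: appa_rho_def field_simps)

lemma cond_nr_ge: "1 \<le> cond_nr L R \<mu>" "L * R\<^sup>2 / \<mu> \<le> cond_nr L R \<mu>"
proof -
  have "0 < L * R\<^sup>2 / \<mu>" using \<mu> L R by simp
  then have "1 \<le> \<lceil>L * R\<^sup>2 / \<mu>\<rceil>" by linarith
  then show "1 \<le> cond_nr L R \<mu>" unfolding cond_nr_def by linarith
  show "L * R\<^sup>2 / \<mu> \<le> cond_nr L R \<mu>" unfolding cond_nr_def by linarith
qed

lemma cond_nr_regularized_le: "cond_nr L R (2 * \<mu> + L * R\<^sup>2) \<le> 1"
proof -
  have "0 < L * R\<^sup>2" using L R by simp
  then have "L * R\<^sup>2 / (2 * \<mu> + L * R\<^sup>2) \<le> 1" using \<mu> by simp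
  then have "\<lceil>L * R\<^sup>2 / (2 * \<mu> + L * R\<^sup>2)\<rceil> \<le> 1" by linarith
  then show ?thesis unfolding cond_nr_def by linarith
qed

text \<open>The first bound is the oracle accuracy the algorithm prescribes; the second puts
  \<open>c\<close> in the range \<open>c \<ge> 2\<close> of the SVRG guarantee.\<close>

lemma appa_accuracy_ge:
  "4 * appa_rho \<mu> (2 * \<mu> + L * R\<^sup>2) powr (3 / 2) \<le> appa_accuracy n \<mu> L R"
  "4 \<le> appa_accuracy n \<mu> L R"
proof -
  let ?p = "4 * appa_rho \<mu> (2 * \<mu> + L * R\<^sup>2) powr (3 / 2)"
  have "?p * 1 \<le> ?p * (1 + 4 * (real n * (L * R\<^sup>2)) / \<mu>)"
    using \<mu> L by (intro mult_left_mono) auto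
  then show ge: "?p \<le> appa_accuracy n \<mu> L R" by (simp add: appa_accuracy_def)
  have "0 < L * R\<^sup>2 / \<mu>" using \<mu> L R by simp
  then have "1 powr (3 / 2) \<le> appa_rho \<mu> (2 * \<mu> + L * R\<^sup>2) powr (3 / 2)"
    unfolding appa_rho_eq by (intro powr_mono2) auto
  then show "4 \<le> appa_accuracy n \<mu> L R" using ge by simp
qed

lemma ln_appa_accuracy_le:
  "ln (appa_accuracy n \<mu> L R) \<le> 117 * polylog 1 n L \<mu> (2 * \<mu> + L * R\<^sup>2) R"
proof -
  let ?\<rho> = "appa_rho \<mu> (2 * \<mu> + L * R\<^sup>2)"
  define s where "s = L * R\<^sup>2 / \<mu>"
  define E where "E = 1 + 4 * (real n * s)"
  define B where "B = polylog 1 n L \<mu> (2 * \<mu> + L * R\<^sup>2) R"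
  have s: "0 < s" using \<mu> L R by (simp add: s_def)
  have ns: "0 < real n * s" using s n by simp
  have "1 * s \<le> real n * s" using n s by (intro mult_right_mono) auto
  then have \<rho>: "1 \<le> ?\<rho>" "?\<rho> \<le> 5 * E"
    using s unfolding appa_rho_eq E_def s_def[symmetric] by auto
  have E: "1 \<le> E" using ns by (simp add: E_def)
  have "?\<rho> powr (3 / 2) \<le> ?\<rho> powr 2" using \<rho> by (intro powr_mono) auto
  also have "\<dots> = ?\<rho>\<^sup>2" using \<rho> by (simp add: powr_numeral)
  also have "\<dots> \<le> (5 * E)\<^sup>2" using \<rho> by (intro power_mono) auto
  finally have "appa_accuracy n \<mu> L R \<le> 4 * (5 * E)\<^sup>2 * E"
    using E by (simp add: appa_accuracy_def E_def s_def)
  also have "\<dots> = 100 * E ^ 3" by (simp add: power2_eq_square power3_eq_cube)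
  finally have "ln (appa_accuracy n \<mu> L R) \<le> ln (100 * E ^ 3)"
    using appa_accuracy_ge(2) E by (subst ln_le_cancel_iff) auto
  also have "\<dots> = ln 100 + 3 * ln E" using E by (simp add: ln_mult ln_realpow)
  also have "ln (100 :: real) \<le> 99" using ln_le_minus_one[of 100] by simp
  \<comment> \<open>Here \<open>n * s\<close> may be below 1; the maximum with 1 leaves a logarithm
    bounded by \<open>\<bar>ln (n * s)\<bar>\<close>, which splits into the terms of
    \<open>polylog\<close>.\<close>
  also have "ln E \<le> ln (5 * max 1 (real n * s))"
  proof -
    have "E \<le> 5 * max 1 (real n * s)"
      using max.cobounded1[of 1 "real n * s"] max.cobounded2[of "real n * s" 1]
      unfolding E_def by linarith
    then show ?thesis using E by (subst ln_le_cancel_iff) auto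
  qed
  also have "\<dots> = ln 5 + ln (max 1 (real n * s))" using ns by (subst ln_mult) auto
  also have "ln (5 :: real) \<le> 4" using ln_le_minus_one[of 5] by simp
  also have "ln (max 1 (real n * s)) \<le> \<bar>ln (real n * s)\<bar>" by (simp add: max_def)
  also have "ln (real n * s) = ln (real n) + ln L + 2 * ln R - ln \<mu>"
    using n \<mu> L R by (simp add: s_def ln_mult ln_div ln_realpow)
  also have "\<bar>\<dots>\<bar> \<le> 2 * (B - 1)" by (simp add: B_def polylog_def)
  \<comment> \<open>The right-hand side is \<open>105 + 6 * B\<close>, below \<open>117 * B\<close>
    because \<open>B \<ge> 1\<close>.\<close>
  finally have "ln (appa_accuracy n \<mu> L R) \<le> 99 + 3 * (4 + 2 * (B - 1))" by simp
  moreover have "1 \<le> B" by (simp add: B_def polylog_def)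
  ultimately show ?thesis unfolding B_def[symmetric] by simp
qed

lemma appa_iterations_contract:
  assumes x: "1 < x"
  shows "(1 - appa_rho \<mu> (2 * \<mu> + L * R\<^sup>2) powr (- 1 / 2) / 2) ^ appa_iterations n \<mu> L R x
    \<le> 1 / (2 * x)"
proof -
  let ?\<rho> = "appa_rho \<mu> (2 * \<mu> + L * R\<^sup>2)"
  let ?T = "appa_iterations n \<mu> L R x"
  have "0 < L * R\<^sup>2 / \<mu>" using \<mu> L R by simp
  then have \<rho>: "1 \<le> ?\<rho>" unfolding appa_rho_eq by simp
  define r where "r = ?\<rho> powr (- 1 / 2)"
  have r: "r = 1 / sqrt ?\<rho>" using \<rho> by (simp add: r_def powr_minus powr_half_sqrt divide_simps)
  have r1: "0 < r" "r \<le> 1" using \<rho> by (auto simp: r)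
  have "2 * sqrt ?\<rho> * ln (2 * x) \<le> real ?T"
    unfolding appa_iterations_def by linarith
  then have "r / 2 * (2 * sqrt ?\<rho> * ln (2 * x)) \<le> r / 2 * real ?T"
    using r1 by (intro mult_left_mono) auto
  moreover have "r / 2 * (2 * sqrt ?\<rho> * ln (2 * x)) = ln (2 * x)" using \<rho> by (simp add: r)
  ultimately have T: "ln (2 * x) \<le> r / 2 * real ?T" by (simp only:)
  have "(1 - r / 2) ^ ?T \<le> exp (- (r / 2)) ^ ?T"
    using r1 exp_ge_add_one_self[of "- (r / 2)"] by (intro power_mono) auto
  also have "\<dots> = exp (- (r / 2 * real ?T))" by (simp add: exp_of_nat_mult[symmetric] mult.commute)
  also have "\<dots> \<le> exp (- ln (2 * x))" using T by simp
  also have "\<dots> = 1 / (2 * x)" using x by (simp add: exp_minus divide_simps)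
  finally show ?thesis by (simp add: r_def)
qed

text \<open>As \<open>x \<ge> q > 1\<close>, constants are at most \<open>ln x / ln q\<close>, which
  \<open>w\<close> absorbs: first the \<open>ln 2\<close> in \<open>ln (2 * x)\<close>, then the
  rounding up. The 7 is \<open>2 * 3\<close> plus 1 for the ceiling; the second claim also absorbs
  start-up costs later.\<close>

lemma appa_iterations_le:
  assumes q: "1 < q" "q \<le> x"
  defines "w \<equiv> 1 + 1 / ln q"
  shows "real (appa_iterations n \<mu> L R x) \<le> 7 * w * (sqrt (cond_nr L R \<mu>) * ln x)"
    and "1 \<le> w * (sqrt (cond_nr L R \<mu>) * ln x)"
proof -
  let ?\<rho> = "appa_rho \<mu> (2 * \<mu> + L * R\<^sup>2)"
  let ?\<kappa> = "cond_nr L R \<mu>"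
  have lq: "0 < ln q" "ln q \<le> ln x" using q by auto
  have k: "1 \<le> sqrt ?\<kappa>" using cond_nr_ge by simp
  have one: "1 \<le> 1 / ln q * ln x" using lq by simp
  also have "1 / ln q * ln x \<le> w * ln x"
    using lq by (intro mult_right_mono) (auto simp: w_def)
  finally have w1: "1 \<le> w * ln x" .
  then have "1 * (w * ln x) \<le> sqrt ?\<kappa> * (w * ln x)"
    using k by (intro mult_right_mono) auto
  then show ge: "1 \<le> w * (sqrt ?\<kappa> * ln x)" using w1 by (simp add: mult_ac)
  have "ln (2 * x) = ln 2 + ln x" using q by (simp add: ln_mult)
  also have "ln (2 :: real) \<le> 1" using ln_le_minus_one[of 2] by simp
  finally have l2: "ln (2 * x) \<le> w * ln x" using one by (simp add: w_def algebra_simps)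
  \<comment> \<open>From \<open>5 + 2 * s \<le> 7 * \<kappa>\<close>, rounded up to a perfect
    square.\<close>
  have "?\<rho> \<le> 3\<^sup>2 * ?\<kappa>" unfolding appa_rho_eq using cond_nr_ge by simp
  then have "sqrt ?\<rho> \<le> sqrt (3\<^sup>2 * ?\<kappa>)" by (rule real_sqrt_le_mono)
  also have "\<dots> = 3 * sqrt ?\<kappa>" by (simp add: real_sqrt_mult)
  finally have "sqrt ?\<rho> \<le> 3 * sqrt ?\<kappa>" .
  moreover have "0 \<le> ?\<rho>" using \<mu> L by (simp add: appa_rho_eq)
  ultimately have "2 * sqrt ?\<rho> * ln (2 * x) \<le> 2 * (3 * sqrt ?\<kappa>) * (w * ln x)"
    using l2 q k by (intro mult_mono) auto
  moreover have "0 \<le> 2 * sqrt ?\<rho> * ln (2 * x)"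
    using q \<mu> L by (auto simp: appa_rho_eq)
  then have "real (appa_iterations n \<mu> L R x) \<le> 2 * sqrt ?\<rho> * ln (2 * x) + 1"
    unfolding appa_iterations_def by linarith
  ultimately show "real (appa_iterations n \<mu> L R x) \<le> 7 * w * (sqrt ?\<kappa> * ln x)"
    using ge by (simp add: mult_ac)
qed

end

text \<open>Accuracy and iteration count are fixed before the SVRG constant \<open>A\<close>, so the
  algorithm does not depend on it; \<open>C\<close> and \<open>k\<close> depend only on
  \<open>A\<close> and \<open>q\<close>. The bound \<open>q > 1\<close> keeps
  \<open>ln (\<epsilon>0 / \<epsilon>)\<close> away from 0.\<close>

theorem corollary3p2:
  shows "\<exists>(acc :: nat \<Rightarrow> real \<Rightarrow> real \<Rightarrow> real \<Rightarrow> real) (iters :: nat \<Rightarrow> real \<Rightarrow> real \<Rightarrow> real \<Rightarrow> real \<Rightarrow> nat).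
    \<forall>A>0. \<forall>q>1. \<exists>C>0. \<exists>k.
      \<forall>(n::nat) (d::nat) (\<psi> :: nat \<Rightarrow> rvec \<Rightarrow> real) (F :: rvec \<Rightarrow> real)
        (\<mu>::real) (L::real) (R::real) (lam::real) (c::real)
        (S :: real \<Rightarrow> real \<Rightarrow> rvec \<Rightarrow> rvec timed) (x0::rvec) (\<epsilon>0::real) (\<epsilon>::real).
        1 \<le> n \<longrightarrow> 1 \<le> d \<longrightarrow> 0 < \<mu> \<longrightarrow> 0 < L \<longrightarrow> 0 < R \<longrightarrow>
        F = (\<lambda>x. \<Sum>i=1..n. \<psi> i x) \<longrightarrow>
        (\<forall>i\<in>{1..n}. smooth d (L * R\<^sup>2) (\<psi> i)) \<longrightarrow>
        strongly_convex d \<mu> F \<longrightarrow>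
        svrg_guarantee A n d F \<mu> L R S \<longrightarrow>
        lam = 2 * \<mu> + L * R\<^sup>2 \<longrightarrow>
        c = acc n \<mu> L R \<longrightarrow>
        x0 \<in> carrier_vec d \<longrightarrow>
        \<epsilon>0 = F x0 - min_val d F \<longrightarrow>
        0 < \<epsilon> \<longrightarrow> q \<le> \<epsilon>0 / \<epsilon> \<longrightarrow>
        4 * appa_rho \<mu> lam powr (3 / 2) \<le> c \<and>
        (let run = accelerated_appa d \<mu> lam (S lam c) x0 (iters n \<mu> L R (\<epsilon>0 / \<epsilon>)) in
           expect_le run (\<lambda>x. F x - min_val d F) \<epsilon> \<and>
           time_at_most
             (C * polylog k n L \<mu> lam R *
                (real n * real d * sqrt (cond_nr L R \<mu>) * ln (\<epsilon>0 / \<epsilon>))) run)"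
proof (rule exI[of _ appa_accuracy], rule exI[of _ appa_iterations], intro allI impI)
  fix A q :: real
  assume A: "0 < A" and q: "1 < q"
  define w where "w = 1 + 1 / ln q"
  have w: "0 < w" using q by (simp add: w_def add_pos_pos)
  \<comment> \<open>The 13 covers the start-up cost \<open>d + 12\<close>, the 7 the iteration
    count, the 10 the vector operations of an iteration and \<open>117 * A\<close> its oracle call.
    Only \<open>ln c\<close> contributes a logarithmic factor, so \<open>k = 1\<close>
    serves.\<close>
  define C where "C = w * (13 + 7 * (10 + 117 * A))"
  show "\<exists>C>0. \<exists>k.
      \<forall>(n::nat) (d::nat) (\<psi> :: nat \<Rightarrow> rvec \<Rightarrow> real) (F :: rvec \<Rightarrow> real)
        (\<mu>::real) (L::real) (R::real) (lam::real) (c::real)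
        (S :: real \<Rightarrow> real \<Rightarrow> rvec \<Rightarrow> rvec timed) (x0::rvec) (\<epsilon>0::real) (\<epsilon>::real).
        1 \<le> n \<longrightarrow> 1 \<le> d \<longrightarrow> 0 < \<mu> \<longrightarrow> 0 < L \<longrightarrow> 0 < R \<longrightarrow>
        F = (\<lambda>x. \<Sum>i=1..n. \<psi> i x) \<longrightarrow>
        (\<forall>i\<in>{1..n}. smooth d (L * R\<^sup>2) (\<psi> i)) \<longrightarrow>
        strongly_convex d \<mu> F \<longrightarrow>
        svrg_guarantee A n d F \<mu> L R S \<longrightarrow>
        lam = 2 * \<mu> + L * R\<^sup>2 \<longrightarrow>
        c = appa_accuracy n \<mu> L R \<longrightarrow>
        x0 \<in> carrier_vec d \<longrightarrow>
        \<epsilon>0 = F x0 - min_val d F \<longrightarrow>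
        0 < \<epsilon> \<longrightarrow> q \<le> \<epsilon>0 / \<epsilon> \<longrightarrow>
        4 * appa_rho \<mu> lam powr (3 / 2) \<le> c \<and>
        (let run = accelerated_appa d \<mu> lam (S lam c) x0 (appa_iterations n \<mu> L R (\<epsilon>0 / \<epsilon>)) in
           expect_le run (\<lambda>x. F x - min_val d F) \<epsilon> \<and>
           time_at_most
             (C * polylog k n L \<mu> lam R *
                (real n * real d * sqrt (cond_nr L R \<mu>) * ln (\<epsilon>0 / \<epsilon>))) run)"
  proof (rule exI[of _ C], rule conjI, simp add: C_def w A add_pos_pos, rule exI[of _ 1],
      intro allI impI)
    fix n d :: nat and \<psi> :: "nat \<Rightarrow> rvec \<Rightarrow> real" and F :: "rvec \<Rightarrow> real"
      and \<mu> L R lam c :: real and S :: "real \<Rightarrow> real \<Rightarrow> rvec \<Rightarrow> rvec timed"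
      and x0 :: rvec and \<epsilon>0 \<epsilon> :: real
    assume n: "1 \<le> n" and d: "1 \<le> d" and \<mu>: "0 < \<mu>" and L: "0 < L" and R: "0 < R"
      and F: "F = (\<lambda>x. \<Sum>i=1..n. \<psi> i x)" and sm: "\<forall>i\<in>{1..n}. smooth d (L * R\<^sup>2) (\<psi> i)"
      and sc: "strongly_convex d \<mu> F" and svrg: "svrg_guarantee A n d F \<mu> L R S"
      and lam: "lam = 2 * \<mu> + L * R\<^sup>2" and c: "c = appa_accuracy n \<mu> L R"
      and x0: "x0 \<in> carrier_vec d" and \<epsilon>0: "\<epsilon>0 = F x0 - min_val d F"
      and \<epsilon>: "0 < \<epsilon>" and qx: "q \<le> \<epsilon>0 / \<epsilon>"
    note params = n \<mu> L R
    define x where "x = \<epsilon>0 / \<epsilon>"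
    define T where "T = appa_iterations n \<mu> L R x"
    define M where "M = real n * (L * R\<^sup>2)"
    define \<tau> where "\<tau> = A * (real n * real d * min (cond_nr L R \<mu>) (cond_nr L R lam) * ln c)"
    let ?run = "accelerated_appa d \<mu> lam (S lam c) x0 T"
    have lam0: "lam > 0" using \<mu> L by (simp add: lam add_pos_nonneg)
    have M: "M > 0" using n L R by (simp add: M_def)
    have FM: "smooth d M F" using sm unfolding F M_def by (intro smooth_sum) auto
    have bdd: "bdd_below (F ` carrier_vec d)"
    proof -
      obtain g where "has_gradient d F g x0" using FM x0 unfolding smooth_def by blast
      then show ?thesis by (rule strongly_convex_bdd_below[OF sc \<mu> x0])
    qed
    have P: "primal_oracle d F c lam \<tau> (S lam c)"
      using svrg lam0 appa_accuracy_ge(2)[OF params] unfolding svrg_guarantee_def \<tau>_def c by auto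
    have x: "1 < x" using q qx by (simp add: x_def)
    have \<epsilon>0x: "\<epsilon>0 = x * \<epsilon>" using \<epsilon> by (simp add: x_def)
    have "expect_le ?run (\<lambda>x. F x - min_val d F)
        ((1 - appa_rho \<mu> lam powr (- 1 / 2) / 2) ^ T * (2 * (F x0 - min_val d F)))"
      by (rule accelerated_appa_converges[OF sc bdd \<mu> lam0 M FM P _ x0])
        (simp add: c appa_accuracy_def lam M_def)
    moreover have "(1 - appa_rho \<mu> lam powr (- 1 / 2) / 2) ^ T * (2 * (F x0 - min_val d F))
        \<le> 1 / (2 * x) * (2 * (F x0 - min_val d F))"
      unfolding T_def lam using x \<epsilon>
      by (intro mult_right_mono appa_iterations_contract[OF params])
        (auto simp: \<epsilon>0[symmetric] \<epsilon>0x)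
    moreover have "1 / (2 * x) * (2 * (F x0 - min_val d F)) = \<epsilon>"
      using x by (simp add: \<epsilon>0[symmetric] \<epsilon>0x)
    ultimately have expect: "expect_le ?run (\<lambda>x. F x - min_val d F) \<epsilon>"
      unfolding expect_le_def by linarith
    define B where "B = polylog 1 n L \<mu> lam R"
    define W where "W = w * (sqrt (cond_nr L R \<mu>) * ln x)"
    define N where "N = real n * real d"
    have B: "1 \<le> B" by (simp add: B_def polylog_def)
    have W: "1 \<le> W" "real T \<le> 7 * W"
      using appa_iterations_le[OF params q qx[folded x_def], folded w_def]
      by (auto simp: W_def T_def mult.assoc)
    have "1 * 1 \<le> N" "1 * real d \<le> N" unfolding N_def using n d by (intro mult_mono; simp)+
    then have N: "1 \<le> N" "real d \<le> N" by auto
    have lnc: "0 \<le> ln c" "ln c \<le> 117 * B"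
      using appa_accuracy_ge(2)[OF params] ln_appa_accuracy_le[OF params] by (auto simp: c B_def lam)
    \<comment> \<open>The choice of \<open>lam\<close> pays off here: the regularized condition
      number is at most 1, so an oracle call costs only \<open>n * d * ln c\<close> up to a
      constant.\<close>
    have "N * min (cond_nr L R \<mu>) (cond_nr L R lam) * ln c \<le> N * 1 * (117 * B)"
    proof (rule mult_mono)
      show "N * min (cond_nr L R \<mu>) (cond_nr L R lam) \<le> N * 1"
        using cond_nr_regularized_le[OF params] N by (intro mult_left_mono) (auto simp: lam)
    qed (use lnc N in auto)
    then have \<tau>: "\<tau> \<le> A * (N * 1 * (117 * B))"
      unfolding \<tau>_def N_def[symmetric] using A by (intro mult_left_mono) auto
    have NB: "N \<le> N * B" using N B by simp
    have "10 * real d + \<tau> \<le> (10 + 117 * A) * (N * B)"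
      using \<tau> NB N(2) by (simp add: algebra_simps)
    then have "real T * (10 * real d + \<tau>) \<le> real T * ((10 + 117 * A) * (N * B))"
      by (intro mult_left_mono) auto
    also have "\<dots> \<le> 7 * W * ((10 + 117 * A) * (N * B))"
      using W A N B by (intro mult_right_mono) auto
    finally have t1: "real T * (10 * real d + \<tau>) \<le> 7 * W * ((10 + 117 * A) * (N * B))" .
    \<comment> \<open>The start-up cost is charged to a single iteration's worth of work, using
      \<open>W \<ge> 1\<close>.\<close>
    have "real d + 12 \<le> 1 * (13 * (N * B))" using N NB by linarith
    also have "1 * (13 * (N * B)) \<le> W * (13 * (N * B))"
      using W N B by (intro mult_right_mono) auto
    finally have "real d + 12 + real T * (10 * real d + \<tau>)
        \<le> W * (13 * (N * B)) + 7 * W * ((10 + 117 * A) * (N * B))"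
      using t1 by linarith
    also have "\<dots> = C * B * (N * sqrt (cond_nr L R \<mu>) * ln x)"
      by (simp add: C_def W_def algebra_simps)
    finally have "time_at_most (C * B * (N * sqrt (cond_nr L R \<mu>) * ln x)) ?run"
      by (rule time_at_most_mono[OF accelerated_appa_time[OF P x0]])
    then show "4 * appa_rho \<mu> lam powr (3 / 2) \<le> c \<and>
        (let run = accelerated_appa d \<mu> lam (S lam c) x0 (appa_iterations n \<mu> L R (\<epsilon>0 / \<epsilon>)) in
           expect_le run (\<lambda>x. F x - min_val d F) \<epsilon> \<and>
           time_at_most
             (C * polylog 1 n L \<mu> lam R *
                (real n * real d * sqrt (cond_nr L R \<mu>) * ln (\<epsilon>0 / \<epsilon>))) run)"
      using expect appa_accuracy_ge(1)[OF params]
      by (simp add: Let_def T_def x_def B_def N_def c lam)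
  qed
qed

end
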